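(* Let $N\in\mathbb{N}$, $a\ge0$, $b>0$, and put $\alpha:=a+b-1$, $\beta:=b-1$. For $\kappa>0$ let $\tilde X_\kappa$ be a random variable with values in $\tilde A:=\{t\in\mathbb{R}^N:\ \frac{\pi}{2}\ge t_1\ge\dots\ge t_N\ge 0\}$ whose distribution has Lebesgue density $$\tilde c_\kappa\prod_{1\le i<j\le N}\bigl(\cos(2t_j)-\cos(2t_i)\bigr)^{\kappa}\prod_{i=1}^N\sin(t_i)^{\kappa a}\sin(2t_i)^{\kappa b}$$ on $\tilde A$, with normalizing constant $\tilde c_\kappa>0$. Let $z_1\le\dots\le z_N$ be the ordered zeros of the Jacobi polynomial $P_N^{(\alpha,\beta)}$ and put $w:=\bigl(\tfrac12\arccos z_1,\dots,\tfrac12\arccos z_N\bigr)$. Then $\sqrt{\kappa}(\tilde X_\kappa-w)$ converges in distribution, as $\kappa\to\infty$, to the centered $N$-dimensional normal distribution $N(0,\tilde\Sigma)$, where the covariance matrix $\tilde\Sigma$ is invertible and its inverse $\tilde S=\tilde\Sigma^{-1}=(\tilde s_{i,j})_{i,j=1,\dots,N}$ is given by $$\tilde s_{j,j}=4\sum_{l\ne j}\frac{1-z_j^2}{(z_j-z_l)^2}+2(a+b)\frac{1+z_j}{1-z_j}+2b\frac{1-z_j}{1+z_j},\qquad \tilde s_{i,j}=\frac{-4\sqrt{(1-z_j^2)(1-z_i^2)}}{(z_i-z_j)^2}\ (i\ne j).$$ Furthermore, the eigenvalues of $\tilde S$ are simple and given by $\lambda_k=2k(2N+\alpha+\beta+1-k)>0$,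 $k=1,\dots,N$, and each $\lambda_k$ has an eigenvector of the form $$v_k=\bigl(q_{k-1}(z_1)\sqrt{1-z_1^2},\dots,q_{k-1}(z_N)\sqrt{1-z_N^2}\bigr)^T,$$ where $q_0,\dots,q_{N-1}$ are polynomials, $q_{k-1}$ of degree $k-1$, which are orthonormal with respect to the discrete measure $\mu_{N,\alpha,\beta}:=\sum_{i=1}^N(1-z_i^2)\delta_{z_i}$.
   Context: For $\alpha,\beta>-1$, $P_N^{(\alpha,\beta)}$ denotes the classical Jacobi polynomial of degree $N$, orthogonal on $]-1,1[$ with respect to the weight $(1-x)^\alpha(1+x)^\beta$; its $N$ zeros are simple and lie in $]-1,1[$. $\delta_x$ denotes the Dirac measure at $x$. *)

theory Defs
  imports "HOL-Probability.Probability" "Jordan_Normal_Form.Char_Poly"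
begin

text \<open>Points of R^N are represented as extensional functions in PiE {..<N} UNIV,
  with coordinates indexed 0..N-1 (coordinate i here is coordinate i+1 in the paper).\<close>

abbreviation RN :: "nat \<Rightarrow> (nat \<Rightarrow> real) set" where
  "RN N \<equiv> PiE {..<N} (\<lambda>_. UNIV)"

abbreviation lebN :: "nat \<Rightarrow> (nat \<Rightarrow> real) measure" where
  "lebN N \<equiv> PiM {..<N} (\<lambda>_. lborel)"

text \<open>Classical Jacobi polynomial P_N^(alpha,beta) (explicit formula, DLMF 18.5.8 form).\<close>
definition jacobi_poly :: "nat \<Rightarrow> real \<Rightarrow> real \<Rightarrow> real poly" where
  "jacobi_poly N al be =
     (\<Sum>s\<le>N. Polynomial.smult (((real N + al) gchoose (N - s)) * ((real N + be) gchoose s))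
        ([:-1/2, 1/2:] ^ s * [:1/2, 1/2:] ^ (N - s)))"

text \<open>The ordered zeros z_1 < ... < z_N (index i here = index i+1 in the paper).\<close>
definition jacobi_zero :: "nat \<Rightarrow> real \<Rightarrow> real \<Rightarrow> nat \<Rightarrow> real" where
  "jacobi_zero N al be i = sorted_list_of_set {x. poly (jacobi_poly N al be) x = 0} ! i"

text \<open>Real power with the convention x^0 = 1 (also for x = 0).\<close>
definition rpow :: "real \<Rightarrow> real \<Rightarrow> real" where
  "rpow x y = (if y = 0 then 1 else x powr y)"

definition chamberA :: "nat \<Rightarrow> (nat \<Rightarrow> real) set" where
  "chamberA N = {t \<in> RN N. (\<forall>i<N. 0 \<le> t i \<and> t i \<le> pi/2) \<and> (\<forall>i j. i < j \<and> j < N \<longrightarrow> t j \<le> t i)}"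

definition trig_dens :: "nat \<Rightarrow> real \<Rightarrow> real \<Rightarrow> real \<Rightarrow> (nat \<Rightarrow> real) \<Rightarrow> real" where
  "trig_dens N a b \<kappa> t =
     (\<Prod>j<N. \<Prod>i<j. rpow (cos (2 * t j) - cos (2 * t i)) \<kappa>) *
     (\<Prod>i<N. rpow (sin (t i)) (\<kappa> * a) * rpow (sin (2 * t i)) (\<kappa> * b))"

definition law_X :: "nat \<Rightarrow> real \<Rightarrow> real \<Rightarrow> real \<Rightarrow> (nat \<Rightarrow> real) measure" where
  "law_X N a b \<kappa> = density (lebN N)
     (\<lambda>t. indicator (chamberA N) t * ennreal (trig_dens N a b \<kappa> t) /
          (\<integral>\<^sup>+ s. indicator (chamberA N) s * ennreal (trig_dens N a b \<kappa> s) \<partial>lebN N))"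

definition centered_normal :: "nat \<Rightarrow> real mat \<Rightarrow> (nat \<Rightarrow> real) measure \<Rightarrow> bool" where
  "centered_normal N Cov \<nu> \<longleftrightarrow> prob_space \<nu> \<and> sets \<nu> = sets (lebN N) \<and>
     (\<forall>u. (\<integral>x. cis (\<Sum>i<N. u i * x i) \<partial>\<nu>) =
          complex_of_real (exp (- (\<Sum>i<N. \<Sum>j<N. u i * Cov $$ (i,j) * u j) / 2)))"

definition conv_distr :: "nat \<Rightarrow> (real \<Rightarrow> (nat \<Rightarrow> real) measure) \<Rightarrow> (nat \<Rightarrow> real) measure \<Rightarrow> bool" where
  "conv_distr N M \<nu> \<longleftrightarrow>
     (\<forall>f :: (nat \<Rightarrow> real) \<Rightarrow> real. continuous_on (RN N) f \<and> bounded (f ` RN N) \<longrightarrow>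
        ((\<lambda>\<kappa>. \<integral>x. f x \<partial>M \<kappa>) \<longlongrightarrow> (\<integral>x. f x \<partial>\<nu>)) at_top)"

end

theory Submission
  imports Defs "HOL-Complex_Analysis.Conformal_Mappings"
begin

text \<open>
  In the coordinates \<open>t\<close>, minus the logarithm of the density divided by \<open>\<kappa>\<close> is a sum of terms
  \<open>- ln (sin (l t))\<close> over linear forms \<open>l\<close> that take values in \<open>[0, pi]\<close> on the chamber. Since
  \<open>- ln (sin y) - y^2 / 2\<close> is convex, this potential is strongly convex: around its minimiser \<open>w\<close> the
  rescaled densities are dominated by one Gaussian, and Laplace's method gives convergence to the
  Gaussian whose precision matrix is the Hessian at \<open>w\<close>. The critical point equations are Stieltjes'
  equations for \<open>cos (2 * w i)\<close>, so the polynomial with these roots solves the Jacobi differential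
  equation; its polynomial solutions of the given eigenvalue are unique up to scaling, hence the roots are
  the Jacobi zeros. Written on polynomials of degree less than \<open>N\<close>, the Hessian is triangular with
  distinct diagonal entries, which yields the eigenvalues and eigenvectors.
\<close>

section \<open>Jacobi polynomials and Stieltjes' equations\<close>

text \<open>The point \<open>w\<close> is given through Jacobi zeros, of which nothing is known at
  the start: not that they are real, simple, or in ]-1,1[. The proof therefore begins with a
  maximiser of the density on the compact chamber. It turns out to be interior, so its coordinates
  are distinct and ordered, and only afterwards is it identified with \<open>w\<close>; location and
  simplicity of the zeros come out on the way. Strong convexity rests on (- ln sin)'' = 1 / sin^2 >=
  1. It holds on the whole chamber, so the tails need no estimate of their own. The forms 2 t_j of
  multiplicity b alone supply the constant 4 b, also when a = 0. At a general point the stated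
  diagonal entries of the Hessian are not the second derivatives of the potential: the two agree at
  \<open>w\<close> only after Stieltjes' equations are inserted. These enter once more when the
  Hessian is turned into an operator on polynomials. The Gaussian normalisation stays an unevaluated
  integral, so no determinant has to be computed.\<close>

definition jacobi_op :: "real \<Rightarrow> real \<Rightarrow> real poly \<Rightarrow> real poly" where
  "jacobi_op al be p =
     [:1, 0, -1:] * pderiv (pderiv p) + [:be - al, - (al + be + 2):] * pderiv p"

lemma coeff_jacobi_op:
  "coeff (jacobi_op al be p) n =
     (real n + 1) * (real n + 2) * coeff p (n + 2) + (be - al) * (real n + 1) * coeff p (n + 1)
     - real n * (real n + al + be + 1) * coeff p n"
  by (cases n; cases "n - 1")
     (auto simp: jacobi_op_def coeff_pderiv coeff_pCons algebra_simps split: nat.splits)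

lemma jacobi_op_add: "jacobi_op al be (p + q) = jacobi_op al be p + jacobi_op al be q"
  by (simp only: jacobi_op_def pderiv_add distrib_left add_ac)

lemma jacobi_op_smult: "jacobi_op al be (Polynomial.smult c p) = Polynomial.smult c (jacobi_op al be p)"
  by (simp add: jacobi_op_def pderiv_smult smult_add_right)

lemma jacobi_op_sum: "jacobi_op al be (sum f A) = (\<Sum>s\<in>A. jacobi_op al be (f s))"
proof (induction A rule: infinite_finite_induct)
  case (insert x F)
  then show ?case by (simp add: jacobi_op_add)
qed (simp_all add: jacobi_op_def)

text \<open>Comparing leading coefficients gives (n - N) (n + N + al + be + 1) = 0 for the degree n,
  and the second factor is positive unless n = N. This is the uniqueness tool: an eigenpolynomial
  whose coefficient at N vanishes must be zero.\<close>

lemma jacobi_eigenpoly_degree: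
  fixes p :: "real poly"
  assumes "al + be > - 2" and "p \<noteq> 0"
    and eq: "jacobi_op al be p = Polynomial.smult (- (real N * (real N + al + be + 1))) p"
  shows "degree p = N"
proof -
  let ?n = "degree p"
  have "coeff (jacobi_op al be p) ?n = - (real ?n * (real ?n + al + be + 1)) * lead_coeff p"
    by (simp add: coeff_jacobi_op coeff_eq_0)
  moreover have "coeff (jacobi_op al be p) ?n = - (real N * (real N + al + be + 1)) * lead_coeff p"
    using eq by simp
  ultimately have "real ?n * (real ?n + al + be + 1) = real N * (real N + al + be + 1)"
    using \<open>p \<noteq> 0\<close> by (metis leading_coeff_0_iff minus_equation_iff mult_right_cancel)
  then have "(real ?n - real N) * (real ?n + real N + al + be + 1) = 0"
    by (simp add: algebra_simps)
  moreover have "real ?n + real N + al + be + 1 > 0" if "?n \<noteq> N"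
  proof -
    have "?n + N \<ge> 1" using that by linarith
    then have "real ?n + real N \<ge> 1" by linarith
    then show ?thesis using assms(1) by linarith
  qed
  ultimately show ?thesis by fastforce
qed

text \<open>With U = (x - 1) / 2 and W = (x + 1) / 2 one has 1 - x^2 = -4 U W, and the drift is a
  combination of U and W. Hence the operator is tridiagonal on the products U^m W^n of fixed total
  degree, the basis in which \<open>jacobi_poly\<close> is written. Truncated exponents are
  harmless, since their coefficients vanish.\<close>

lemma jacobi_op_basis:
  fixes al be :: real and m n :: nat
  defines "U \<equiv> [:-1/2, 1/2 :: real:]" and "W \<equiv> [:1/2, 1/2 :: real:]"
  shows "jacobi_op al be (U ^ m * W ^ n) =
     - (Polynomial.smult (real m * (real m + al)) (U ^ (m - 1) * W ^ (n + 1))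
      + Polynomial.smult (2 * real m * real n + (al + 1) * real n + (be + 1) * real m) (U ^ m * W ^ n)
      + Polynomial.smult (real n * (real n + be)) (U ^ (m + 1) * W ^ (n - 1)))"
proof -
  have c: "[:1, 0, -1:] = Polynomial.smult (-4) (U * W)"
    "[:be - al, - (al + be + 2):] =
      Polynomial.smult (- 2 * (al + 1)) W + Polynomial.smult (- 2 * (be + 1)) U"
    by (simp_all add: U_def W_def field_simps)
  have dU: "pderiv U = [:1/2:]" "pderiv W = [:1/2:]"
    by (simp_all add: U_def W_def pderiv_pCons)
  have ev: "poly (pderiv (V ^ k)) x = real k / 2 * poly V x ^ (k - 1)"
    if "pderiv V = [:1/2:]" for V :: "real poly" and k x
    by (cases k) (simp_all add: pderiv_power_Suc that del: power_Suc)
  have ev2: "poly (pderiv (pderiv (V ^ k))) x = real k * (real k - 1) / 4 * poly V x ^ (k - 2)"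
    if "pderiv V = [:1/2:]" for V :: "real poly" and k x
  proof (cases k)
    case (Suc k')
    then show ?thesis
      by (cases k') (simp_all add: pderiv_power_Suc that pderiv_mult pderiv_smult pderiv_add field_simps del: power_Suc)
  qed simp
  have "poly (jacobi_op al be (U ^ m * W ^ n)) x = poly
     (- (Polynomial.smult (real m * (real m + al)) (U ^ (m - 1) * W ^ (n + 1))
      + Polynomial.smult (2 * real m * real n + (al + 1) * real n + (be + 1) * real m) (U ^ m * W ^ n)
      + Polynomial.smult (real n * (real n + be)) (U ^ (m + 1) * W ^ (n - 1)))) x" for x
  proof -
    define u w where "u = poly U x" and "w = poly W x"
    \<comment> \<open>The factors k and k (k - 1) vanish exactly when the exponent k - 1 or k - 2 is
      truncated, so powers may be merged without case distinctions.\<close>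
    have red: "(real k * (real k - 1)) * v ^ (k - 2) * v = real k * (real k - 1) * v ^ (k - 1)"
      "real k * v ^ (k - 1) * v = real k * v ^ k" for k and v :: real
      by (cases k; cases "k - 1"; simp)+
    have "poly (jacobi_op al be (U ^ m * W ^ n)) x =
      -4 * (u * w) * (real m * (real m - 1) / 4 * u ^ (m - 2) * w ^ n
          + 2 * (real m / 2 * u ^ (m - 1)) * (real n / 2 * w ^ (n - 1))
          + u ^ m * (real n * (real n - 1) / 4 * w ^ (n - 2)))
      + (- 2 * (al + 1) * w - 2 * (be + 1) * u) *
          (real m / 2 * u ^ (m - 1) * w ^ n + u ^ m * (real n / 2 * w ^ (n - 1)))"
      unfolding jacobi_op_def c
      by (simp add: pderiv_mult pderiv_add ev[OF dU(1)] ev[OF dU(2)] ev2[OF dU(1)] ev2[OF dU(2)]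
          u_def[symmetric] w_def[symmetric]) (simp add: algebra_simps)
    also have "\<dots> = - (((real m * (real m - 1)) * u ^ (m - 2) * u) * w ^ n * w
          + 2 * (real m * u ^ (m - 1) * u) * (real n * w ^ (n - 1) * w)
          + u ^ m * u * ((real n * (real n - 1)) * w ^ (n - 2) * w))
      - (al + 1) * (real m * u ^ (m - 1) * w ^ n * w + u ^ m * (real n * w ^ (n - 1) * w))
      - (be + 1) * ((real m * u ^ (m - 1) * u) * w ^ n + u ^ m * u * (real n * w ^ (n - 1)))"
      by (simp add: field_simps)
    also have "\<dots> = - (real m * (real m + al) * (u ^ (m - 1) * w ^ (n + 1))
      + (2 * real m * real n + (al + 1) * real n + (be + 1) * real m) * (u ^ m * w ^ n)
      + real n * (real n + be) * (u ^ (m + 1) * w ^ (n - 1)))"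
      unfolding red by (simp add: algebra_simps)
    finally show ?thesis by (simp add: u_def w_def)
  qed
  then show ?thesis by (metis poly_eq_poly_eq_iff ext)
qed


lemma gbinomial_Suc_mult: "(x gchoose (Suc k)) * real (Suc k) = (x gchoose k) * (x - real k)" for x :: real
  using gbinomial_mult_1[of x k] by (simp add: algebra_simps)

text \<open>The ratio of consecutive coefficients is such that the down-shifted sum and the
  up-shifted sum both become diagonal again; the three diagonal coefficients then add up to a number
  independent of s.\<close>

lemma jacobi_poly_ode:
  "jacobi_op al be (jacobi_poly N al be) =
     Polynomial.smult (- (real N * (real N + al + be + 1))) (jacobi_poly N al be)"
proof -
  define U W where "U = [:-1/2, 1/2 :: real:]" and "W = [:1/2, 1/2 :: real:]"
  define A where "A s = ((real N + al) gchoose (N - s)) * ((real N + be) gchoose s)" for s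
  define B where "B s = U ^ s * W ^ (N - s)" for s
  \<comment> \<open>With N = s + k + 1 the factors produced by the two binomials are N + al - k = (s
    + 1) + al and N + be - s = (N - s) + be.\<close>
  have rec: "A (Suc s) * (real (Suc s) * (real (Suc s) + al)) = A s * (real (N - s) * (real (N - s) + be))"
    if "s < N" for s
  proof -
    have "\<exists>k. N = Suc (s + k)" using that by (rule less_imp_Suc_add)
    then obtain k where k: "N = Suc (s + k)" by blast
    have e: "N - s = Suc k" "N - Suc s = k" using k by auto
    have "A (Suc s) * (real (Suc s) * (real (Suc s) + al)) =
        (((real N + al) gchoose k) * (real N + al - real k)) * (((real N + be) gchoose (Suc s)) * real (Suc s))"
      unfolding A_def e using k by (simp add: algebra_simps)
    also have "\<dots> = (((real N + al) gchoose (Suc k)) * real (Suc k)) * (((real N + be) gchoose s) * (real N + be - real s))"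
      by (simp only: gbinomial_Suc_mult)
    also have "\<dots> = A s * (real (N - s) * (real (N - s) + be))"
      unfolding A_def e using k by (simp add: algebra_simps)
    finally show ?thesis .
  qed
  have jp: "jacobi_poly N al be = (\<Sum>s\<le>N. Polynomial.smult (A s) (B s))"
    by (simp add: jacobi_poly_def A_def B_def U_def W_def)
  have dn: "(\<Sum>s\<le>N. Polynomial.smult (A s * (real s * (real s + al))) (U ^ (s - 1) * W ^ (N - s + 1)))
      = (\<Sum>s\<le>N. Polynomial.smult (A s * (real (N - s) * (real (N - s) + be))) (B s))"
  proof -
    have "(\<Sum>s\<le>N. Polynomial.smult (A s * (real s * (real s + al))) (U ^ (s - 1) * W ^ (N - s + 1)))
        = (\<Sum>s<N. Polynomial.smult (A (Suc s) * (real (Suc s) * (real (Suc s) + al))) (U ^ s * W ^ (N - Suc s + 1)))"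
      by (cases N) (simp_all add: sum.atMost_shift lessThan_Suc_atMost del: sum.atMost_Suc of_nat_Suc)
    also have "\<dots> = (\<Sum>s<N. Polynomial.smult (A s * (real (N - s) * (real (N - s) + be))) (B s))"
      by (intro sum.cong refl) (auto simp: rec B_def Suc_diff_Suc simp del: of_nat_Suc power_Suc)
    also have "\<dots> = (\<Sum>s\<le>N. Polynomial.smult (A s * (real (N - s) * (real (N - s) + be))) (B s))"
      by (simp add: lessThan_Suc_atMost[symmetric])
    finally show ?thesis .
  qed
  have up: "(\<Sum>s\<le>N. Polynomial.smult (A s * (real (N - s) * (real (N - s) + be))) (U ^ (s + 1) * W ^ (N - s - 1)))
      = (\<Sum>s\<le>N. Polynomial.smult (A s * (real s * (real s + al))) (B s))"
  proof -
    have "(\<Sum>s\<le>N. Polynomial.smult (A s * (real (N - s) * (real (N - s) + be))) (U ^ (s + 1) * W ^ (N - s - 1)))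
        = (\<Sum>s<N. Polynomial.smult (A s * (real (N - s) * (real (N - s) + be))) (U ^ (s + 1) * W ^ (N - s - 1)))"
      by (simp add: lessThan_Suc_atMost[symmetric])
    also have "\<dots> = (\<Sum>s<N. Polynomial.smult (A (Suc s) * (real (Suc s) * (real (Suc s) + al))) (B (Suc s)))"
      by (intro sum.cong refl) (auto simp: rec B_def simp del: of_nat_Suc)
    also have "\<dots> = (\<Sum>s\<le>N. Polynomial.smult (A s * (real s * (real s + al))) (B s))"
      by (cases N) (simp_all add: sum.atMost_shift lessThan_Suc_atMost del: sum.atMost_Suc of_nat_Suc)
    finally show ?thesis .
  qed
  have "jacobi_op al be (jacobi_poly N al be) =
     - ((\<Sum>s\<le>N. Polynomial.smult (A s * (real s * (real s + al))) (U ^ (s - 1) * W ^ (N - s + 1)))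
      + (\<Sum>s\<le>N. Polynomial.smult (A s * (2 * real s * real (N - s) + (al + 1) * real (N - s) + (be + 1) * real s)) (B s))
      + (\<Sum>s\<le>N. Polynomial.smult (A s * (real (N - s) * (real (N - s) + be))) (U ^ (s + 1) * W ^ (N - s - 1))))"
    unfolding jp jacobi_op_sum jacobi_op_smult B_def U_def W_def jacobi_op_basis
    by (simp only: sum.distrib sum_negf smult_add_right smult_minus_right smult_smult)
  also have "\<dots> = - (\<Sum>s\<le>N. Polynomial.smult (A s *
      (real (N - s) * (real (N - s) + be) + (2 * real s * real (N - s) + (al + 1) * real (N - s) + (be + 1) * real s)
       + real s * (real s + al))) (B s))"
    unfolding dn up by (simp only: sum.distrib[symmetric] smult_add_left[symmetric] distrib_left[symmetric])
  \<comment> \<open>The quadratic terms combine to ((N - s) + s)^2 and the linear ones to (al + be +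
    1) ((N - s) + s), so s drops out.\<close>
  also have "\<dots> = - (\<Sum>s\<le>N. Polynomial.smult (A s * (real N * (real N + al + be + 1))) (B s))"
    by (intro arg_cong[where f = uminus] sum.cong refl arg_cong2[where f = Polynomial.smult] arg_cong2[where f = times])
       (auto simp: of_nat_diff algebra_simps)
  also have "\<dots> = Polynomial.smult (- (real N * (real N + al + be + 1))) (jacobi_poly N al be)"
    unfolding jp by (simp add: smult_sum2 sum_negf mult.commute)
  finally show ?thesis .
qed

text \<open>At x = 1 only the summand s = 0 survives, and its binomial is a product of positive
  factors.\<close>

lemma jacobi_poly_nonzero:
  assumes "al > -1" shows "jacobi_poly N al be \<noteq> 0"
proof -
  have "poly (jacobi_poly N al be) 1 = (real N + al) gchoose N"
    by (simp add: jacobi_poly_def poly_sum sum.atMost_shift)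
  moreover have "(real N + al) gchoose N > 0"
    unfolding gbinomial_prod_rev using assms by (auto intro!: divide_pos_pos prod_pos)
  ultimately show ?thesis by auto
qed

text \<open>At a simple root, p'' / p' is twice the sum of 1 / (x_i - x_l), so Stieltjes' equation
  says that the residual of the differential equation vanishes there. The leading terms cancel, so
  the residual has degree below N but N distinct roots.\<close>

lemma stieltjes_ode:
  fixes x :: "nat \<Rightarrow> real" and al be :: real and N :: nat
  defines "p \<equiv> (\<Prod>i<N. [:- x i, 1:])"
  assumes inj: "inj_on x {..<N}" and N: "N \<ge> 1"
    and st: "\<And>i. i < N \<Longrightarrow> 2 * (1 - (x i)\<^sup>2) * (\<Sum>l\<in>{..<N} - {i}. 1 / (x i - x l)) = al - be + (al + be + 2) * x i"
  shows "jacobi_op al be p = Polynomial.smult (- (real N * (real N + al + be + 1))) p"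
proof -
  have degp: "degree p = N"
    by (simp add: p_def degree_prod_eq_sum_degree)
  have lcp: "lead_coeff p = 1"
    by (simp only: p_def lead_coeff_prod) simp
  define r where "r = jacobi_op al be p + Polynomial.smult (real N * (real N + al + be + 1)) p"
  have "coeff r n = 0" if "n \<ge> N" for n
  proof (cases "n = N")
    case True
    then show ?thesis using degp lcp by (simp add: r_def coeff_jacobi_op coeff_eq_0)
  next
    case False
    then show ?thesis using degp that by (simp add: r_def coeff_jacobi_op coeff_eq_0)
  qed
  then have "N \<le> degree r \<Longrightarrow> lead_coeff r = 0" by blast
  then have degr: "degree r < N" using N by (cases "r = 0") force+
  have root: "poly r (x i) = 0" if i: "i < N" for i
  proof -
    define g where "g = (\<Prod>j\<in>{..<N} - {i}. [:- x j, 1:])"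
    have pg: "p = [:- x i, 1:] * g"
      unfolding p_def g_def using i by (subst prod.remove[of _ i]) auto
    have ne: "x i - x l \<noteq> 0" if "l \<in> {..<N} - {i}" for l
      using that i inj by (auto simp: inj_on_def)
    have dg: "poly (pderiv g) (x i) = poly g (x i) * (\<Sum>l\<in>{..<N} - {i}. 1 / (x i - x l))"
      unfolding g_def pderiv_prod sum_distrib_left poly_sum
    proof (rule sum.cong[OF refl])
      fix l assume l: "l \<in> {..<N} - {i}"
      have "(\<Prod>j\<in>{..<N} - {i}. x i - x j) = (x i - x l) * (\<Prod>j\<in>{..<N} - {i} - {l}. x i - x j)"
        using l by (subst prod.remove[of _ l]) auto
      then show "poly ((\<Prod>j\<in>{..<N} - {i} - {l}. [:- x j, 1:]) * pderiv [:- x l, 1:]) (x i)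
        = poly (\<Prod>j\<in>{..<N} - {i}. [:- x j, 1:]) (x i) * (1 / (x i - x l))"
        using ne[OF l] by (simp add: poly_prod pderiv_pCons)
    qed
    have d1: "poly (pderiv p) (x i) = poly g (x i)" and d2: "poly (pderiv (pderiv p)) (x i) = 2 * poly (pderiv g) (x i)"
      unfolding pg by (simp_all add: pderiv_mult pderiv_add pderiv_pCons pderiv_smult del: mult_pCons_left)
    have p0: "poly p (x i) = 0" unfolding pg by simp
    have "poly r (x i) = poly g (x i) * (2 * (1 - (x i)\<^sup>2) * (\<Sum>l\<in>{..<N} - {i}. 1 / (x i - x l)) - (al - be + (al + be + 2) * x i))"
      unfolding r_def jacobi_op_def using p0
      by (simp add: d1 d2 dg) (simp add: algebra_simps power2_eq_square)
    then show ?thesis using st[OF i] by simp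
  qed
  have "r = 0"
    by (rule poly_eqI_degree[where A = "x ` {..<N}"])
       (use root degr card_image[OF inj] in auto)
  then show ?thesis unfolding r_def by (simp add: eq_neg_iff_add_eq_0)
qed

text \<open>Subtracting the right multiple of the product of the X - x_i from the Jacobi polynomial
  leaves an eigenpolynomial without a term of degree N, hence 0. The zero set is thus computed
  exactly, and strict monotonicity makes the list of the x_i the sorted one.\<close>

lemma jacobi_zero_stieltjes:
  fixes x :: "nat \<Rightarrow> real" and al be :: real
  assumes mono: "strict_mono_on {..<N} x" and N: "N \<ge> 1" and "al > -1" "be > -1"
    and st: "\<And>i. i < N \<Longrightarrow> 2 * (1 - (x i)\<^sup>2) * (\<Sum>l\<in>{..<N} - {i}. 1 / (x i - x l)) = al - be + (al + be + 2) * x i"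
    and i: "i < N"
  shows "jacobi_zero N al be i = x i"
proof -
  have inj: "inj_on x {..<N}" using mono strict_mono_on_imp_inj_on by blast
  define p where "p = (\<Prod>i<N. [:- x i, 1:])"
  define J where "J = jacobi_poly N al be"
  define c where "c = - (real N * (real N + al + be + 1))"
  have degp: "degree p = N"
    by (simp add: p_def degree_prod_eq_sum_degree)
  have lcp: "lead_coeff p = 1"
    by (simp only: p_def lead_coeff_prod) simp
  have p: "jacobi_op al be p = Polynomial.smult c p"
    unfolding p_def c_def by (rule stieltjes_ode[OF inj N st])
  have J: "jacobi_op al be J = Polynomial.smult c J"
    unfolding J_def c_def by (rule jacobi_poly_ode)
  have J0: "J \<noteq> 0" unfolding J_def by (rule jacobi_poly_nonzero) fact
  have sum: "al + be > -2" using assms by linarith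
  have degJ: "degree J = N" using jacobi_eigenpoly_degree[OF sum J0 J[unfolded c_def]] .
  define D where "D = J + Polynomial.smult (- lead_coeff J) p"
  have D: "jacobi_op al be D = Polynomial.smult c D"
    unfolding D_def jacobi_op_add jacobi_op_smult p J by (simp add: smult_add_right smult_diff_right mult.commute)
  have "coeff D N = 0" unfolding D_def using degp lcp degJ by simp
  then have "D = 0"
    using jacobi_eigenpoly_degree[OF sum _ D[unfolded c_def]] by (metis leading_coeff_0_iff)
  then have "J = Polynomial.smult (lead_coeff J) p" unfolding D_def by simp
  then have "{y. poly J y = 0} = x ` {..<N}"
    using J0 by (subst (asm) poly_eq_poly_eq_iff[symmetric])
      (auto simp: p_def poly_prod fun_eq_iff)
  then have zs: "{y. poly J y = 0} = set (map x [0..<N])"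
    by (simp add: atLeast0LessThan)
  have "sorted (map x [0..<N])"
    unfolding sorted_iff_nth_mono using mono by (auto simp: strict_mono_on_def le_less)
  moreover have "distinct (map x [0..<N])"
    using inj by (simp add: distinct_map atLeast0LessThan)
  ultimately have "sorted_list_of_set {y. poly J y = 0} = map x [0..<N]"
    unfolding zs by (rule sorted_list_of_set.idem_if_sorted_distinct)
  then show ?thesis using i by (simp add: jacobi_zero_def J_def)
qed

section \<open>The spectrum of the Hessian\<close>

lemma synthetic_div_add: "synthetic_div (p + q) c = synthetic_div p c + synthetic_div q c"
  for p q :: "'a::comm_ring_1 poly"
proof -
  have "p + q + Polynomial.smult c (synthetic_div p c + synthetic_div q c) =
    (p + Polynomial.smult c (synthetic_div p c)) + (q + Polynomial.smult c (synthetic_div q c))"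
    by (simp add: smult_add_right)
  also have "\<dots> = pCons (poly p c + poly q c) (synthetic_div p c + synthetic_div q c)"
    unfolding synthetic_div_correct by simp
  finally show ?thesis by (rule synthetic_div_unique[THEN conjunct2, symmetric])
qed

lemma synthetic_div_smult: "synthetic_div (Polynomial.smult d p) c = Polynomial.smult d (synthetic_div p c)"
  for p :: "'a::comm_ring_1 poly"
proof -
  have "Polynomial.smult d p + Polynomial.smult c (Polynomial.smult d (synthetic_div p c)) =
    Polynomial.smult d (p + Polynomial.smult c (synthetic_div p c))"
    by (simp add: smult_add_right mult.commute)
  also have "\<dots> = pCons (d * poly p c) (Polynomial.smult d (synthetic_div p c))"
    unfolding synthetic_div_correct by simp
  finally show ?thesis by (rule synthetic_div_unique[THEN conjunct2, symmetric])
qed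

lemma coeff_synthetic_div_top:
  fixes p :: "'a::comm_ring_1 poly"
  assumes "\<And>i. i > Suc n \<Longrightarrow> coeff p i = 0"
  shows "coeff (synthetic_div p c) n = coeff p (Suc n)" "\<And>i. i > n \<Longrightarrow> coeff (synthetic_div p c) i = 0"
proof -
  have "degree p \<le> Suc n" using assms degree_le by blast
  then have d: "degree (synthetic_div p c) \<le> n" by (simp add: degree_synthetic_div)
  then show z: "\<And>i. i > n \<Longrightarrow> coeff (synthetic_div p c) i = 0" by (simp add: coeff_eq_0)
  have "coeff (p + Polynomial.smult c (synthetic_div p c)) (Suc n) = coeff (pCons (poly p c) (synthetic_div p c)) (Suc n)"
    by (simp add: synthetic_div_correct)
  then show "coeff (synthetic_div p c) n = coeff p (Suc n)" using z by simp
qed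

text \<open>Both parts come from f = (X - y) s + f(y), where s is the quotient: differentiate once
  and solve for s'(x) when x differs from y, differentiate twice and put x = y for the confluent
  case.\<close>

lemma synthetic_div_pderiv:
  fixes f :: "real poly"
  shows "x \<noteq> y \<Longrightarrow> poly (pderiv (synthetic_div f y)) x =
      poly (pderiv f) x / (x - y) - (poly f x - poly f y) / (x - y)\<^sup>2"
    and "poly (pderiv (synthetic_div f x)) x = poly (pderiv (pderiv f)) x / 2"
proof -
  have f: "f = [:- y, 1:] * synthetic_div f y + [:poly f y:]" for y
    by (metis synthetic_div_correct')
  have d: "pderiv f = [:- y, 1:] * pderiv (synthetic_div f y) + synthetic_div f y" for y
    by (subst (1) f[of y]) (simp add: pderiv_mult pderiv_add pderiv_pCons del: mult_pCons_left)
  have d2: "pderiv (pderiv f) = [:- y, 1:] * pderiv (pderiv (synthetic_div f y)) + 2 * pderiv (synthetic_div f y)" for y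
    by (subst (1) d[of y]) (simp add: pderiv_mult pderiv_add pderiv_pCons del: mult_pCons_left)
  show "poly (pderiv (synthetic_div f x)) x = poly (pderiv (pderiv f)) x / 2"
    by (subst d2[of x]) simp
  have e1: "poly f x = (x - y) * poly (synthetic_div f y) x + poly f y"
    by (subst (1) f[of y]) (simp add: algebra_simps)
  have e2: "poly (pderiv f) x = (x - y) * poly (pderiv (synthetic_div f y)) x + poly (synthetic_div f y) x"
    by (subst (1) d[of y]) (simp add: algebra_simps)
  show "x \<noteq> y \<Longrightarrow> poly (pderiv (synthetic_div f y)) x =
      poly (pderiv f) x / (x - y) - (poly f x - poly f y) / (x - y)\<^sup>2"
    unfolding e2 using e1 by (simp add: add_divide_distrib power2_eq_square)
qed

text \<open>Since mu k differs from all earlier diagonal entries, T - mu k is invertible on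
  polynomials of degree below k. So X^k can be corrected by lower terms to an exact
  eigenpolynomial.\<close>

lemma triangular_eigenpoly:
  fixes T :: "real poly \<Rightarrow> real poly" and mu :: "nat \<Rightarrow> real"
  assumes add: "\<And>p q. T (p + q) = T p + T q"
    and smult: "\<And>c p. T (Polynomial.smult c p) = Polynomial.smult c (T p)"
    and tri: "\<And>n q. (\<And>i. i > n \<Longrightarrow> coeff q i = 0) \<Longrightarrow>
        (\<forall>i>n. coeff (T q) i = 0) \<and> coeff (T q) n = mu n * coeff q n"
    and mu: "\<And>j. j < k \<Longrightarrow> mu j \<noteq> mu k"
  shows "\<exists>q. degree q = k \<and> lead_coeff q = 1 \<and> T q = Polynomial.smult (mu k) q"
proof -
  have solve: "\<exists>s. (\<forall>i\<ge>n. coeff s i = 0) \<and> T s - Polynomial.smult (mu k) s = r"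
    if "n \<le> k" "\<forall>i\<ge>n. coeff r i = 0" for n r
    using that
  proof (induction n arbitrary: r)
    case 0
    then have "r = 0" by (simp add: poly_eq_iff)
    moreover have "T 0 = 0" using smult[of 0 0] by simp
    ultimately show ?case by (intro exI[of _ 0]) simp
  next
    case (Suc n)
    \<comment> \<open>T - mu k multiplies a coefficient at the top position n by mu n - mu k, so
      this monomial removes the top coefficient of r.\<close>
    define c where "c = coeff r n / (mu n - mu k)"
    define s0 where "s0 = monom c n"
    have s0: "coeff s0 i = 0" if "i > n" for i using that by (simp add: s0_def)
    have ne: "mu n \<noteq> mu k" using mu Suc.prems by simp
    have "\<forall>i\<ge>n. coeff (r - (T s0 - Polynomial.smult (mu k) s0)) i = 0"
    proof (intro allI impI)
      fix i assume "n \<le> i"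
      then consider "i = n" | "i > n" by linarith
      then show "coeff (r - (T s0 - Polynomial.smult (mu k) s0)) i = 0"
      proof cases
        case 1
        then show ?thesis using tri[OF s0] ne by (simp add: s0_def c_def field_simps)
      next
        case 2
        then show ?thesis using tri[OF s0] s0 Suc.prems by simp
      qed
    qed
    from Suc.IH[OF _ this] obtain s where s: "\<forall>i\<ge>n. coeff s i = 0"
      "T s - Polynomial.smult (mu k) s = r - (T s0 - Polynomial.smult (mu k) s0)"
      using Suc.prems(1) by auto
    have "T (s + s0) - Polynomial.smult (mu k) (s + s0) = r"
      using s(2) by (simp add: add smult_add_right algebra_simps)
    moreover have "\<forall>i\<ge>Suc n. coeff (s + s0) i = 0" using s(1) s0 by auto
    ultimately show ?case by blast
  qed
  define m where "m = (monom 1 k :: real poly)"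
  have m: "coeff m i = 0" if "i > k" for i using that by (simp add: m_def)
  have "\<forall>i\<ge>k. coeff (T m - Polynomial.smult (mu k) m) i = 0"
    using tri[OF m] m by (simp add: le_less)
  then obtain s where s: "\<forall>i\<ge>k. coeff s i = 0"
    "T s - Polynomial.smult (mu k) s = T m - Polynomial.smult (mu k) m"
    using solve[OF order_refl] by blast
  define q where "q = m + Polynomial.smult (-1) s"
  have "coeff q k = 1" "\<forall>i>k. coeff q i = 0" using s(1) by (auto simp: q_def m_def)
  then have "degree q = k" by (intro antisym degree_le le_degree) simp_all
  moreover have "T q = Polynomial.smult (mu k) q"
    unfolding q_def add smult smult_add_right using s(2) by (simp add: algebra_simps)
  ultimately show ?thesis using \<open>coeff q k = 1\<close> by blast
qed

text \<open>On vectors of the form \<open>poly q (z i) * sqrt (1 - (z i)^2)\<close> the Hessian acts as an operator on the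
  polynomial \<open>q\<close>. Here \<open>pderiv (synthetic_div f y)\<close> is the divided difference \<open>f[x, x, y]\<close> as a
  polynomial in \<open>x\<close>; the sum runs over all nodes, so the term \<open>f[x, x, x] = f'' / 2\<close> is added back.\<close>

definition spec_op :: "nat \<Rightarrow> (nat \<Rightarrow> real) \<Rightarrow> real \<Rightarrow> real \<Rightarrow> real poly \<Rightarrow> real poly" where
  "spec_op N z a b q =
     Polynomial.smult (-4) (\<Sum>l<N. pderiv (synthetic_div ([:1, 0, -1:] * q) (z l)))
     + Polynomial.smult 2 (pderiv (pderiv ([:1, 0, -1:] * q)))
     + [:2 * a, 2 * (a + 2 * b):] * pderiv q + Polynomial.smult (2 * (a + 2 * b)) q"

lemma spec_op_add: "spec_op N z a b (p + q) = spec_op N z a b p + spec_op N z a b q"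
  by (simp only: spec_op_def distrib_left synthetic_div_add pderiv_add sum.distrib smult_add_right add_ac)

lemma spec_op_smult: "spec_op N z a b (Polynomial.smult c q) = Polynomial.smult c (spec_op N z a b q)"
  by (simp only: spec_op_def mult_smult_right synthetic_div_smult pderiv_smult smult_sum2 smult_add_right
      smult_smult mult.commute[of c])

text \<open>Multiplication by 1 - x^2 raises the degree by two and each second order term lowers it
  by two. In the leading coefficient a divided difference sees only the leading coefficient of its
  polynomial, not its node, so only the number N of nodes enters. The diagonal entry is the
  eigenvalue with index n + 1 of the theorem.\<close>

lemma spec_op_triangular:
  assumes q: "\<And>i. i > n \<Longrightarrow> coeff q i = 0"
  shows "(\<forall>i>n. coeff (spec_op N z a b q) i = 0) \<and>
    coeff (spec_op N z a b q) n = 2 * (real n + 1) * (2 * real N + a + 2 * b - real n - 2) * coeff q n"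
proof -
  define f where "f = [:1, 0, -1:] * q"
  have fc: "coeff f (Suc (Suc i)) = coeff q (Suc (Suc i)) - coeff q i" for i
    by (simp add: f_def coeff_pCons)
  have f0: "coeff f i = 0" if "i > Suc (Suc n)" for i
  proof -
    have "i = Suc (Suc (i - 2))" "i - 2 > n" "i > n" using that by auto
    then show ?thesis using fc[of "i - 2"] q[of "i - 2"] q[of i] by simp
  qed
  have sd1: "coeff (synthetic_div f y) (Suc n) = coeff f (Suc (Suc n))" for y
    by (rule coeff_synthetic_div_top(1)) (rule f0)
  have sd2: "coeff (synthetic_div f y) i = 0" if "i > Suc n" for i y
    by (rule coeff_synthetic_div_top(2)[OF _ that]) (rule f0)
  have c: "coeff (spec_op N z a b q) i =
      -4 * (\<Sum>l<N. real (Suc i) * coeff (synthetic_div f (z l)) (Suc i))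
      + 2 * (real (Suc i) * (real (Suc (Suc i)) * coeff f (Suc (Suc i))))
      + 2 * a * (real (Suc i) * coeff q (Suc i)) + 2 * (a + 2 * b) * (real i * coeff q i)
      + 2 * (a + 2 * b) * coeff q i" for i
    unfolding spec_op_def f_def[symmetric]
    by (cases i) (simp_all add: coeff_sum coeff_pderiv coeff_pCons algebra_simps)
  show ?thesis
  proof (intro conjI allI impI)
    fix i assume "n < i"
    then have "coeff q i = 0" "coeff q (Suc i) = 0" "coeff f (Suc (Suc i)) = 0"
      "coeff (synthetic_div f y) (Suc i) = 0" for y
      by (auto intro: q f0 sd2)
    then show "coeff (spec_op N z a b q) i = 0" unfolding c by simp
  next
    show "coeff (spec_op N z a b q) n = 2 * (real n + 1) * (2 * real N + a + 2 * b - real n - 2) * coeff q n"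
      unfolding c sd1 fc using q[of "Suc n"] q[of "Suc (Suc n)"] by (simp add: algebra_simps)
  qed
qed

text \<open>The entries of \<open>S\<close> as a function on indices, for arbitrary nodes. Its
  relation to the potential is \<open>hess_quad_form\<close>.\<close>

definition hess :: "nat \<Rightarrow> (nat \<Rightarrow> real) \<Rightarrow> real \<Rightarrow> real \<Rightarrow> nat \<Rightarrow> nat \<Rightarrow> real" where
  "hess N z a b i j = (if i = j then
                4 * (\<Sum>l\<in>{..<N} - {j}. (1 - (z j)\<^sup>2) / (z j - z l)\<^sup>2)
                + 2 * (a + b) * (1 + z j) / (1 - z j) + 2 * b * (1 - z j) / (1 + z j)
              else - 4 * sqrt ((1 - (z j)\<^sup>2) * (1 - (z i)\<^sup>2)) / (z i - z j)\<^sup>2)"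

lemma hess_sym: "hess N z a b i j = hess N z a b j i"
  using power2_commute[of "z i" "z j"] by (simp add: hess_def mult.commute)

text \<open>Here q0 and q1 stand for q(x) and q'(x), the bracket (1 - x^2) q1 - 2 x q0 for the
  derivative of (1 - x^2) q, and a + (a + 2 b) x for the sum evaluated by Stieltjes' equation. The
  terms with q1 cancel.\<close>

lemma stieltjes_potential_identity:
  fixes a b x q0 q1 :: real
  shows "(2 * (a + b) * (1 + x)\<^sup>2 + 2 * b * (1 - x)\<^sup>2) * q0 =
      -2 * ((1 - x\<^sup>2) * q1 - 2 * x * q0) * (a + (a + 2 * b) * x)
      + (1 - x\<^sup>2) * ((2 * a + 2 * (a + 2 * b) * x) * q1) + (1 - x\<^sup>2) * (2 * (a + 2 * b) * q0)"
  by (simp add: power2_eq_square algebra_simps)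

text \<open>The square root in the vector completes the one in the matrix entry to the weight 1 -
  z_i^2, so only f = (1 - x^2) q appears. The interaction becomes the sum of (f(z_j) - f(z_i)) /
  (z_j - z_i)^2, which is minus the sum of the divided differences f[z_j, z_j, z_i] plus f'(z_j)
  times the Stieltjes sum.\<close>

lemma hess_spec_op:
  assumes inj: "inj_on z {..<N}" and z: "\<And>i. i < N \<Longrightarrow> -1 < z i \<and> z i < 1"
    and st: "\<And>i. i < N \<Longrightarrow> 2 * (1 - (z i)\<^sup>2) * (\<Sum>l\<in>{..<N} - {i}. 1 / (z i - z l)) = a + (a + 2 * b) * z i"
    and j: "j < N"
  shows "(\<Sum>i<N. hess N z a b j i * (poly q (z i) * sqrt (1 - (z i)\<^sup>2)))
    = sqrt (1 - (z j)\<^sup>2) * poly (spec_op N z a b q) (z j)"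
proof -
  have pos: "1 - (z i)\<^sup>2 > 0" if "i < N" for i
    using z[OF that] by (simp add: abs_square_less_1 abs_less_iff)
  define f where "f = [:1, 0, -1:] * q"
  define x where "x = z j"
  define d where "d = sqrt (1 - x\<^sup>2)"
  have fv: "poly f y = (1 - y\<^sup>2) * poly q y" for y by (simp add: f_def algebra_simps power2_eq_square)
  have f1: "poly (pderiv f) x = (1 - x\<^sup>2) * poly (pderiv q) x - 2 * x * poly q x"
    unfolding f_def by (subst pderiv_mult) (simp add: pderiv_pCons algebra_simps power2_eq_square)
  have x: "-1 < x" "x < 1" "1 - x\<^sup>2 > 0" using z[OF j] pos[OF j] by (auto simp: x_def)
  let ?J = "{..<N} - {j}"
  define s1 where "s1 = (\<Sum>l\<in>?J. 1 / (x - z l))"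
  define s2 where "s2 = (\<Sum>l\<in>?J. (poly f x - poly f (z l)) / (x - z l)\<^sup>2)"
  define pot where "pot = 2 * (a + b) * (1 + x) / (1 - x) + 2 * b * (1 - x) / (1 + x)"
  have ne: "x \<noteq> z l" if "l \<in> ?J" for l using that inj j by (auto simp: inj_on_def x_def)
  have s1: "2 * (1 - x\<^sup>2) * s1 = a + (a + 2 * b) * x" using st[OF j] by (simp add: s1_def x_def)
  have split: "sum g {..<N} = g j + sum g ?J" for g :: "nat \<Rightarrow> real"
    using j by (simp add: sum.remove)
  have off: "hess N z a b j i * (poly q (z i) * sqrt (1 - (z i)\<^sup>2)) = d * (- 4 * poly f (z i) / (x - z i)\<^sup>2)"
    if "i \<in> ?J" for i
  proof -
    have i: "i < N" "i \<noteq> j" using that by auto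
    have "hess N z a b j i = - 4 * (sqrt (1 - (z i)\<^sup>2) * d) / (x - z i)\<^sup>2"
      using i by (simp add: hess_def x_def d_def real_sqrt_mult)
    then have "hess N z a b j i * (poly q (z i) * sqrt (1 - (z i)\<^sup>2)) =
       d * (- 4 * ((sqrt (1 - (z i)\<^sup>2) * sqrt (1 - (z i)\<^sup>2)) * poly q (z i)) / (x - z i)\<^sup>2)"
      by (simp add: algebra_simps)
    then show ?thesis using pos[OF i(1)] by (simp add: fv)
  qed
  have L: "(\<Sum>i<N. hess N z a b j i * (poly q (z i) * sqrt (1 - (z i)\<^sup>2))) = d * (4 * s2 + pot * poly q x)"
  proof -
    have "(\<Sum>i\<in>?J. hess N z a b j i * (poly q (z i) * sqrt (1 - (z i)\<^sup>2)))
       = d * (\<Sum>i\<in>?J. - 4 * poly f (z i) / (x - z i)\<^sup>2)"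
      unfolding sum_distrib_left by (rule sum.cong[OF refl off])
    moreover have "s2 = (\<Sum>i\<in>?J. (1 - x\<^sup>2) / (x - z i)\<^sup>2) * poly q x - (\<Sum>i\<in>?J. poly f (z i) / (x - z i)\<^sup>2)"
      unfolding s2_def sum_distrib_right sum_subtractf[symmetric]
      by (rule sum.cong[OF refl]) (simp add: fv[of x] diff_divide_distrib left_diff_distrib)
    moreover have "(\<Sum>i\<in>?J. - 4 * poly f (z i) / (x - z i)\<^sup>2) = - 4 * (\<Sum>i\<in>?J. poly f (z i) / (x - z i)\<^sup>2)"
      by (simp add: sum_distrib_left)
    moreover have "hess N z a b j j = 4 * (\<Sum>i\<in>?J. (1 - x\<^sup>2) / (x - z i)\<^sup>2) + pot"
      by (simp add: hess_def x_def pot_def)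
    ultimately show ?thesis unfolding split
      by (simp add: x_def[symmetric] d_def[symmetric]) (simp add: algebra_simps)
  qed
  have R: "poly (spec_op N z a b q) x = -4 * (poly (pderiv f) x * s1 - s2)
      + (2 * a + 2 * (a + 2 * b) * x) * poly (pderiv q) x + 2 * (a + 2 * b) * poly q x"
  proof -
    have "(\<Sum>l<N. poly (pderiv (synthetic_div f (z l))) x) =
      poly (pderiv (pderiv f)) x / 2 + (poly (pderiv f) x * s1 - s2)"
      unfolding split s1_def s2_def sum_distrib_left sum_subtractf[symmetric]
      using synthetic_div_pderiv(2)[of f x] synthetic_div_pderiv(1)[OF ne]
      by (simp add: x_def)
    then show ?thesis unfolding spec_op_def f_def[symmetric]
      by (simp add: poly_sum) (simp add: algebra_simps)
  qed
  have p: "(1 - x\<^sup>2) * pot = 2 * (a + b) * (1 + x)\<^sup>2 + 2 * b * (1 - x)\<^sup>2"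
  proof -
    have ne: "1 - x \<noteq> 0" "1 + x \<noteq> 0" using x by auto
    have gen: "u * v * (2 * (a + b) * v / u + 2 * b * u / v) = 2 * (a + b) * v\<^sup>2 + 2 * b * u\<^sup>2"
      if "u \<noteq> 0" "v \<noteq> 0" for u v :: real
      using that by (simp add: field_simps power2_eq_square)
    have "1 - x\<^sup>2 = (1 - x) * (1 + x)" by (simp add: algebra_simps power2_eq_square)
    then show ?thesis unfolding pot_def by (simp only: gen[OF ne])
  qed
  have "(1 - x\<^sup>2) * (pot * poly q x) = (1 - x\<^sup>2) * (- 4 * (poly (pderiv f) x * s1)
      + (2 * a + 2 * (a + 2 * b) * x) * poly (pderiv q) x + 2 * (a + 2 * b) * poly q x)"
  proof -
    have "(1 - x\<^sup>2) * (- 4 * (poly (pderiv f) x * s1)) = -2 * poly (pderiv f) x * (2 * (1 - x\<^sup>2) * s1)"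
      by (simp add: algebra_simps)
    then have "(1 - x\<^sup>2) * (- 4 * (poly (pderiv f) x * s1)) =
      -2 * ((1 - x\<^sup>2) * poly (pderiv q) x - 2 * x * poly q x) * (a + (a + 2 * b) * x)"
      by (simp only: s1 f1)
    moreover have "(1 - x\<^sup>2) * (pot * poly q x) = (2 * (a + b) * (1 + x)\<^sup>2 + 2 * b * (1 - x)\<^sup>2) * poly q x"
      using p by (simp only: mult.assoc[symmetric])
    moreover have "(2 * (a + b) * (1 + x)\<^sup>2 + 2 * b * (1 - x)\<^sup>2) * poly q x =
      -2 * ((1 - x\<^sup>2) * poly (pderiv q) x - 2 * x * poly q x) * (a + (a + 2 * b) * x)
      + (1 - x\<^sup>2) * ((2 * a + 2 * (a + 2 * b) * x) * poly (pderiv q) x)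
      + (1 - x\<^sup>2) * (2 * (a + 2 * b) * poly q x)"
      by (rule stieltjes_potential_identity)
    ultimately show ?thesis unfolding distrib_left[of "1 - x\<^sup>2"] by linarith
  qed
  then have "pot * poly q x = - 4 * (poly (pderiv f) x * s1)
      + (2 * a + 2 * (a + 2 * b) * x) * poly (pderiv q) x + 2 * (a + 2 * b) * poly q x"
    using x(3) by simp
  then have "poly (spec_op N z a b q) x = 4 * s2 + pot * poly q x" unfolding R by simp
  then show ?thesis unfolding L by (simp add: x_def d_def)
qed

text \<open>The weight 1 - z_i^2 makes the discrete inner product of polynomials equal to the
  Euclidean one of the associated vectors. Orthogonality is then that of eigenvectors of a symmetric
  matrix for different eigenvalues; only a rescaling remains.\<close>

lemma hess_eigenpolys:
  fixes a b :: real
  assumes inj: "inj_on z {..<N}" and z: "\<And>i. i < N \<Longrightarrow> -1 < z i \<and> z i < 1"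
    and st: "\<And>i. i < N \<Longrightarrow> 2 * (1 - (z i)\<^sup>2) * (\<Sum>l\<in>{..<N} - {i}. 1 / (z i - z l)) = a + (a + 2 * b) * z i"
    and a: "a \<ge> 0" and b: "b > 0"
  obtains q :: "nat \<Rightarrow> real poly" where
    "\<And>k. k < N \<Longrightarrow> degree (q k) = k"
    "\<And>k l. k < N \<Longrightarrow> l < N \<Longrightarrow> (\<Sum>i<N. (1 - (z i)\<^sup>2) * poly (q k) (z i) * poly (q l) (z i)) = (if k = l then 1 else 0)"
    "\<And>k j. k < N \<Longrightarrow> j < N \<Longrightarrow> (\<Sum>i<N. hess N z a b j i * (poly (q k) (z i) * sqrt (1 - (z i)\<^sup>2))) =
       2 * (real k + 1) * (2 * real N + a + 2 * b - real k - 2) * (poly (q k) (z j) * sqrt (1 - (z j)\<^sup>2))"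
proof -
  define mu where "mu k = 2 * (real k + 1) * (2 * real N + a + 2 * b - real k - 2)" for k
  have mu: "mu j \<noteq> mu k" if "j < N" "k < N" "j \<noteq> k" for j k
  proof -
    have "mu j - mu k = 2 * (real j - real k) * (2 * real N + a + 2 * b - 3 - real j - real k)"
      by (simp add: mu_def algebra_simps)
    \<comment> \<open>Distinct indices below N are at most N - 1 and N - 2.\<close>
    moreover have "j + k + 3 \<le> 2 * N" using that by linarith
    then have "2 * real N - 3 - real j - real k \<ge> 0" by linarith
    then have "2 * real N + a + 2 * b - 3 - real j - real k > 0" using a b by linarith
    ultimately show ?thesis using that by auto
  qed
  have "\<exists>q. degree q = k \<and> lead_coeff q = 1 \<and> spec_op N z a b q = Polynomial.smult (mu k) q" if "k < N" for k
  proof (rule triangular_eigenpoly[where T = "spec_op N z a b" and mu = mu and k = k])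
    show "mu j \<noteq> mu k" if "j < k" for j using mu that \<open>k < N\<close> by simp
    show "(\<forall>i>n. coeff (spec_op N z a b q) i = 0) \<and> coeff (spec_op N z a b q) n = mu n * coeff q n"
      if "\<And>i. i > n \<Longrightarrow> coeff q i = 0" for n q
      unfolding mu_def by (rule spec_op_triangular) (rule that)
  qed (rule spec_op_add spec_op_smult)+
  then have "\<forall>k. \<exists>q. k < N \<longrightarrow> degree q = k \<and> lead_coeff q = 1 \<and> spec_op N z a b q = Polynomial.smult (mu k) q"
    by blast
  from choice[OF this] obtain Q where
    QQ: "\<forall>k. k < N \<longrightarrow> degree (Q k) = k \<and> lead_coeff (Q k) = 1 \<and> spec_op N z a b (Q k) = Polynomial.smult (mu k) (Q k)"
    by (rule exE)
  then have Q: "degree (Q k) = k" "lead_coeff (Q k) = 1"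
    "spec_op N z a b (Q k) = Polynomial.smult (mu k) (Q k)" if "k < N" for k
    using that by blast+
  have pos: "1 - (z i)\<^sup>2 > 0" if "i < N" for i
    using z[OF that] by (simp add: abs_square_less_1 abs_less_iff)
  define v where "v q i = poly q (z i) * sqrt (1 - (z i)\<^sup>2)" for q :: "real poly" and i
  define ip where "ip p q = (\<Sum>i<N. (1 - (z i)\<^sup>2) * poly p (z i) * poly q (z i))" for p q :: "real poly"
  have ipv: "ip p q = (\<Sum>i<N. v p i * v q i)" for p q
    unfolding ip_def v_def
  proof (rule sum.cong[OF refl])
    fix i assume "i \<in> {..<N}"
    then have "sqrt (1 - (z i)\<^sup>2) * sqrt (1 - (z i)\<^sup>2) = 1 - (z i)\<^sup>2" using pos[of i] by simp
    then show "(1 - (z i)\<^sup>2) * poly p (z i) * poly q (z i) =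
      poly p (z i) * sqrt (1 - (z i)\<^sup>2) * (poly q (z i) * sqrt (1 - (z i)\<^sup>2))"
      by (simp add: mult_ac)
  qed
  have eig: "(\<Sum>i<N. hess N z a b j i * v (Q k) i) = mu k * v (Q k) j" if "k < N" "j < N" for k j
    using hess_spec_op[OF inj z st that(2), of "Q k"] Q(3)[OF that(1)] by (simp add: v_def mult_ac)
  have orth: "ip (Q k) (Q l) = 0" if "k < N" "l < N" "k \<noteq> l" for k l
  proof -
    have "mu k * ip (Q k) (Q l) = (\<Sum>j<N. (\<Sum>i<N. hess N z a b j i * v (Q k) i) * v (Q l) j)"
      unfolding ipv sum_distrib_left using eig[OF that(1)] by (intro sum.cong refl) (simp add: mult_ac)
    also have "\<dots> = (\<Sum>i<N. (\<Sum>j<N. hess N z a b i j * v (Q l) j) * v (Q k) i)"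
      unfolding sum_distrib_right
      by (subst sum.swap) (intro sum.cong refl, subst hess_sym, rule mult.assoc[THEN trans], subst mult.assoc, rule arg_cong, rule mult.commute)
    also have "\<dots> = mu l * ip (Q k) (Q l)"
      unfolding ipv sum_distrib_left using eig[OF that(2)] by (intro sum.cong refl) (simp add: mult_ac)
    finally show ?thesis using mu[OF that] by simp
  qed
  have norm: "ip (Q k) (Q k) > 0" if k: "k < N" for k
  proof -
    \<comment> \<open>A nonzero polynomial of degree k < N cannot vanish at all N nodes.\<close>
    have "\<exists>i<N. poly (Q k) (z i) \<noteq> 0"
    proof (rule ccontr)
      assume "\<not> ?thesis"
      then have "Q k = 0"
        by (intro poly_eqI_degree[where A = "z ` {..<N}"]) (use k Q(1) card_image[OF inj] in auto)
      then show False using Q(2)[OF k] by simp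
    qed
    then obtain i where i: "i < N" "poly (Q k) (z i) \<noteq> 0" by blast
    have "0 < (1 - (z i)\<^sup>2) * poly (Q k) (z i) * poly (Q k) (z i)"
      using pos[OF i(1)] i(2) by (metis mult.assoc mult_pos_pos not_real_square_gt_zero)
    then show ?thesis unfolding ip_def
      by (intro sum_pos2[of _ i]) (use i pos in \<open>auto simp: mult.assoc less_imp_le\<close>)
  qed
  define q where "q k = Polynomial.smult (1 / sqrt (ip (Q k) (Q k))) (Q k)" for k
  have vq: "v (q k) i = (1 / sqrt (ip (Q k) (Q k))) * v (Q k) i" for k i by (simp add: v_def q_def)
  show ?thesis
  proof (rule that[of q])
    show "degree (q k) = k" if "k < N" for k
      using Q(1)[OF that] norm[OF that] by (simp add: q_def)
    show "(\<Sum>i<N. (1 - (z i)\<^sup>2) * poly (q k) (z i) * poly (q l) (z i)) = (if k = l then 1 else 0)"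
      if "k < N" "l < N" for k l
    proof -
      have "(\<Sum>i<N. (1 - (z i)\<^sup>2) * poly (q k) (z i) * poly (q l) (z i)) = ip (q k) (q l)"
        by (simp add: ip_def)
      also have "\<dots> = (1 / sqrt (ip (Q k) (Q k))) * (1 / sqrt (ip (Q l) (Q l))) * ip (Q k) (Q l)"
        unfolding ipv[of "q k"] ipv[of "Q k" "Q l"] vq sum_distrib_left by (intro sum.cong refl) (simp add: mult_ac)
      also have "\<dots> = (if k = l then 1 else 0)"
        using orth[OF that] norm[OF that(1)] by auto
      finally show ?thesis .
    qed
    show "(\<Sum>i<N. hess N z a b j i * (poly (q k) (z i) * sqrt (1 - (z i)\<^sup>2))) =
       2 * (real k + 1) * (2 * real N + a + 2 * b - real k - 2) * (poly (q k) (z j) * sqrt (1 - (z j)\<^sup>2))"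
      if "k < N" "j < N" for k j
    proof -
      define c where "c = 1 / sqrt (ip (Q k) (Q k))"
      have "(\<Sum>i<N. hess N z a b j i * v (q k) i) = c * (\<Sum>i<N. hess N z a b j i * v (Q k) i)"
        unfolding vq c_def[symmetric] sum_distrib_left by (intro sum.cong refl) (simp add: mult_ac)
      also have "\<dots> = mu k * v (q k) j" unfolding eig[OF that] vq c_def[symmetric] by simp
      finally show ?thesis by (simp only: v_def mu_def)
    qed
  qed
qed

text \<open>Two monic polynomials of degree N that agree at N points are equal. This form of the
  spectrum carries the simplicity of the eigenvalues.\<close>

lemma char_poly_distinct_eigenvalues:
  fixes A :: "'a::field mat"
  assumes A: "A \<in> carrier_mat N N" and I: "finite I" "card I = N" "inj_on lam I"
    and ev: "\<And>k. k \<in> I \<Longrightarrow> eigenvalue A (lam k)"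
  shows "char_poly A = (\<Prod>k\<in>I. [:- lam k, 1:])"
proof (rule poly_eqI_degree_lead_coeff[where A = "lam ` I" and n = N])
  have d: "degree (\<Prod>k\<in>I. [:- lam k, 1:]) = N"
    using I by (simp add: degree_prod_eq_sum_degree)
  then show "degree (\<Prod>k\<in>I. [:- lam k, 1:]) \<le> N" by simp
  show "degree (char_poly A) \<le> N" using degree_monic_char_poly[OF A] by simp
  have "lead_coeff (\<Prod>k\<in>I. [:- lam k, 1:]) = 1" by (simp only: lead_coeff_prod) simp
  then show "coeff (char_poly A) N = coeff (\<Prod>k\<in>I. [:- lam k, 1:]) N"
    using d degree_monic_char_poly[OF A] by simp
  show "N \<le> card (lam ` I)" using card_image[OF I(3)] I(2) by simp
  show "poly (char_poly A) x = poly (\<Prod>k\<in>I. [:- lam k, 1:]) x" if "x \<in> lam ` I" for x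
    using that ev eigenvalue_root_char_poly[OF A] I(1) by (auto simp: poly_prod)
qed

lemma pos_def_mat_inverse:
  fixes A :: "real mat"
  assumes A: "A \<in> carrier_mat N N"
    and pd: "\<And>v. v \<in> carrier_vec N \<Longrightarrow> v \<noteq> 0\<^sub>v N \<Longrightarrow> v \<bullet> (A *\<^sub>v v) > 0"
  obtains B where "B \<in> carrier_mat N N" "B * A = 1\<^sub>m N" "A * B = 1\<^sub>m N"
proof -
  have "det A \<noteq> 0"
  proof
    assume "det A = 0"
    then obtain v where v: "v \<in> carrier_vec N" "v \<noteq> 0\<^sub>v N" "A *\<^sub>v v = 0\<^sub>v N"
      using det_0_iff_vec_prod_zero[OF A] by blast
    then show False using pd[OF v(1,2)] by simp
  qed
  then have "A \<in> Units (ring_mat TYPE(real) N ())" by (rule det_non_zero_imp_unit[OF A])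
  then show ?thesis using that by (auto simp: Units_def ring_mat_simps)
qed

section \<open>Gaussian measures with given precision matrix\<close>

interpretation lebesgue_coordinates: product_sigma_finite "\<lambda>_. lborel :: real measure"
  by unfold_locales

abbreviation (input) affN :: "nat \<Rightarrow> real \<Rightarrow> (nat \<Rightarrow> real) \<Rightarrow> (nat \<Rightarrow> real) \<Rightarrow> (nat \<Rightarrow> real)" where
  "affN N c w t \<equiv> \<lambda>i\<in>{..<N}. c * (t i - w i)"

lemma affN_measurable [measurable]: "affN N c w \<in> measurable (lebN N) (lebN N)"
  by measurable

text \<open>It suffices to compare boxes, where each coordinate contributes one factor c.\<close>

lemma lebN_affine:
  assumes c: "c > 0"
  shows "density (distr (lebN N) (lebN N) (affN N c w)) (\<lambda>_. ennreal (c ^ N)) = lebN N"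
proof (rule lebesgue_coordinates.PiM_eqI)
  fix A :: "nat \<Rightarrow> real set"
  assume A: "\<And>i. i \<in> {..<N} \<Longrightarrow> A i \<in> sets lborel"
  have fn: "(\<lambda>t. - c * w i + c * t) = (\<lambda>t. c * (t - w i))" for i by (auto simp: algebra_simps)
  define B where "B i = (\<lambda>t. c * (t - w i)) -` A i" for i
  have B: "B i \<in> sets lborel" if "i < N" for i
    using A[of i] that unfolding B_def by (auto intro!: measurable_sets_borel)
  have AB: "emeasure lborel (A i) = ennreal c * emeasure lborel (B i)" if "i < N" for i
  proof -
    have Ai: "A i \<in> sets borel" using A[of i] that by simp
    have "emeasure lborel (A i) =
        emeasure (density (distr lborel borel (\<lambda>t. - c * w i + c * t)) (\<lambda>_. ennreal \<bar>c\<bar>)) (A i)"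
      using lborel_real_affine[of c "- c * w i"] c by simp
    also have "\<dots> = ennreal c * emeasure lborel (B i)"
      unfolding fn using Ai c by (subst emeasure_density_const) (simp_all add: emeasure_distr B_def)
    finally show ?thesis .
  qed
  have "affN N c w -` (PiE {..<N} A) \<inter> space (lebN N) = PiE {..<N} B"
  proof (rule Set.set_eqI)
    fix t
    show "t \<in> affN N c w -` (PiE {..<N} A) \<inter> space (lebN N) \<longleftrightarrow> t \<in> PiE {..<N} B"
      by (simp add: B_def space_PiM PiE_iff)
  qed
  then have "emeasure (distr (lebN N) (lebN N) (affN N c w)) (PiE {..<N} A) = (\<Prod>i<N. emeasure lborel (B i))"
    using A B by (simp add: emeasure_distr sets_PiM_I_finite) (subst lebesgue_coordinates.emeasure_PiM; simp)
  then have "emeasure (density (distr (lebN N) (lebN N) (affN N c w)) (\<lambda>_. ennreal (c ^ N))) (PiE {..<N} A)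
     = ennreal (c ^ N) * (\<Prod>i<N. emeasure lborel (B i))"
    using A by (subst emeasure_density_const) (auto simp: sets_PiM_I_finite)
  also have "\<dots> = (\<Prod>i<N. ennreal c * emeasure lborel (B i))"
    using c by (simp add: prod.distrib ennreal_power)
  also have "\<dots> = (\<Prod>i<N. emeasure lborel (A i))"
    by (intro prod.cong refl) (simp add: AB)
  finally show "emeasure (density (distr (lebN N) (lebN N) (affN N c w)) (\<lambda>_. ennreal (c ^ N))) (PiE {..<N} A)
     = (\<Prod>i<N. emeasure lborel (A i))" .
qed simp_all

lemma integral_lebN_affine:
  fixes F :: "(nat \<Rightarrow> real) \<Rightarrow> real"
  assumes c: "c > 0" and [measurable]: "F \<in> borel_measurable (lebN N)"
  shows "(\<integral>x. F x \<partial>lebN N) = c ^ N * (\<integral>t. F (affN N c w t) \<partial>lebN N)"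
proof -
  have "(\<integral>x. F x \<partial>lebN N) = (\<integral>x. F x \<partial>density (distr (lebN N) (lebN N) (affN N c w)) (\<lambda>_. ennreal (c ^ N)))"
    by (simp only: lebN_affine[OF c])
  also have "\<dots> = (\<integral>x. c ^ N *\<^sub>R F x \<partial>distr (lebN N) (lebN N) (affN N c w))"
    using c by (subst integral_density) auto
  also have "\<dots> = c ^ N * (\<integral>t. F (affN N c w t) \<partial>lebN N)"
    by (subst integral_distr) auto
  finally show ?thesis .
qed

lemma integrable_gaussian_lebN:
  fixes e :: real
  assumes "e > 0"
  shows "integrable (lebN N) (\<lambda>x. exp (- e * (\<Sum>i<N. (x i - w i)\<^sup>2)))"
proof -
  \<comment> \<open>The standard deviation for which the exponent of \<open>normal_density\<close>
    is - e (x - m)^2.\<close>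
  define s where "s = sqrt (1 / (2 * e))"
  have s: "s > 0" "s\<^sup>2 = 1 / (2 * e)" using assms by (auto simp: s_def)
  have "integrable lborel (\<lambda>x. exp (- e * (x - m)\<^sup>2))" for m
  proof -
    have "integrable lborel (\<lambda>x. sqrt (2 * pi * s\<^sup>2) * normal_density m s x)"
      using s(1) by auto
    moreover have "sqrt (2 * pi * s\<^sup>2) * normal_density m s x = exp (- e * (x - m)\<^sup>2)" for x
      using s assms by (simp add: normal_density_def)
    ultimately show ?thesis by simp
  qed
  then have "integrable (lebN N) (\<lambda>x. \<Prod>i<N. exp (- e * (x i - w i)\<^sup>2))"
    by (intro lebesgue_coordinates.product_integrable_prod) auto
  then show ?thesis by (simp add: exp_sum sum_distrib_left)
qed

lemma exp_partial_sum_le: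
  fixes x :: real assumes "x \<ge> 0" shows "(\<Sum>k<n. x ^ k / fact k) \<le> exp x"
proof -
  have "(\<Sum>k<n. inverse (fact k) *\<^sub>R x ^ k) \<le> (\<Sum>k. inverse (fact k) *\<^sub>R x ^ k)"
    using summable_exp_generic[of x] assms by (intro sum_le_suminf) auto
  then show ?thesis by (simp add: exp_def divide_inverse mult.commute)
qed

text \<open>The moment generating function extends to complex arguments and coincides there with exp
  (\<zeta>^2 s / 2) by the identity theorem; its value at the imaginary unit is the characteristic
  function.\<close>

lemma gaussian_mgf_imp_char:
  fixes Y :: "'a \<Rightarrow> real" and s :: real
  assumes "prob_space M" and Y [measurable]: "Y \<in> borel_measurable M"
    and int: "\<And>t. integrable M (\<lambda>x. exp (t * Y x))"
    and mgf: "\<And>t. (\<integral>x. exp (t * Y x) \<partial>M) = exp (t\<^sup>2 * s / 2)"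
  shows "(\<integral>x. cis (Y x) \<partial>M) = complex_of_real (exp (- s / 2))"
proof -
  define F where "F \<zeta> = (\<integral>x. exp (\<zeta> * complex_of_real (Y x)) \<partial>M)" for \<zeta>
  define m where "m k = (\<integral>x. complex_of_real (Y x) ^ k / fact k \<partial>M)" for k
  have dom: "norm (\<Sum>k<n. (\<zeta> * complex_of_real (Y x)) ^ k / fact k) \<le> exp (cmod \<zeta> * Y x) + exp (- cmod \<zeta> * Y x)"
    and dom1: "norm ((\<zeta> * complex_of_real (Y x)) ^ k / fact k) \<le> exp (cmod \<zeta> * Y x) + exp (- cmod \<zeta> * Y x)"
    for \<zeta> n x k
  proof -
    have e: "exp \<bar>y\<bar> \<le> exp y + exp (- y)" for y :: real by (cases "y \<ge> 0") auto
    have nn: "norm ((\<zeta> * complex_of_real (Y x)) ^ k / fact k) = (cmod \<zeta> * \<bar>Y x\<bar>) ^ k / fact k" for k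
      by (simp add: norm_divide norm_power norm_mult)
    have "norm (\<Sum>k<n. (\<zeta> * complex_of_real (Y x)) ^ k / fact k) \<le> (\<Sum>k<n. (cmod \<zeta> * \<bar>Y x\<bar>) ^ k / fact k)"
      unfolding nn[symmetric] by (rule norm_sum)
    also have "\<dots> \<le> exp (cmod \<zeta> * \<bar>Y x\<bar>)" by (rule exp_partial_sum_le) simp
    also have "\<dots> \<le> exp (cmod \<zeta> * Y x) + exp (- cmod \<zeta> * Y x)"
      using e[of "cmod \<zeta> * Y x"] by (simp add: abs_mult)
    finally show "norm (\<Sum>k<n. (\<zeta> * complex_of_real (Y x)) ^ k / fact k) \<le> exp (cmod \<zeta> * Y x) + exp (- cmod \<zeta> * Y x)" .
    have "norm ((\<zeta> * complex_of_real (Y x)) ^ k / fact k) \<le> (\<Sum>k<Suc k. (cmod \<zeta> * \<bar>Y x\<bar>) ^ k / fact k)"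
      unfolding nn by (rule member_le_sum) auto
    also have "\<dots> \<le> exp (cmod \<zeta> * \<bar>Y x\<bar>)" by (rule exp_partial_sum_le) simp
    also have "\<dots> \<le> exp (cmod \<zeta> * Y x) + exp (- cmod \<zeta> * Y x)"
      using e[of "cmod \<zeta> * Y x"] by (simp add: abs_mult)
    finally show "norm ((\<zeta> * complex_of_real (Y x)) ^ k / fact k) \<le> exp (cmod \<zeta> * Y x) + exp (- cmod \<zeta> * Y x)" .
  qed
  have intd: "integrable M (\<lambda>x. exp (r * Y x) + exp (- r * Y x))" for r
    using int by (intro Bochner_Integration.integrable_add) 
  have intk: "integrable M (\<lambda>x. (\<zeta> * complex_of_real (Y x)) ^ k / fact k)" for \<zeta> k
    by (rule Bochner_Integration.integrable_bound[OF intd[of "cmod \<zeta>"]])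
       (simp, intro AE_I2, rule order_trans[OF dom1 abs_ge_self[THEN order_trans]], simp)
  \<comment> \<open>Holomorphy is obtained from a convergent power series in the moments rather than
    by differentiating under the integral; exp (r Y) + exp (- r Y) with r = |\<zeta>| dominates all
    partial sums.\<close>
  have sums: "(\<lambda>k. m k * (\<zeta> - 0) ^ k) sums F \<zeta>" for \<zeta>
  proof -
    have "(\<lambda>n. \<integral>x. (\<Sum>k<n. (\<zeta> * complex_of_real (Y x)) ^ k / fact k) \<partial>M) \<longlonglongrightarrow> F \<zeta>"
      unfolding F_def
    proof (rule integral_dominated_convergence[OF _ _ intd[of "cmod \<zeta>"]])
      show "AE x in M. (\<lambda>n. \<Sum>k<n. (\<zeta> * complex_of_real (Y x)) ^ k / fact k) \<longlonglongrightarrow> exp (\<zeta> * complex_of_real (Y x))"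
        using exp_converges[where 'a = complex] by (intro AE_I2) (simp add: sums_def scaleR_conv_of_real divide_inverse mult.commute)
      show "AE x in M. norm (\<Sum>k<n. (\<zeta> * complex_of_real (Y x)) ^ k / fact k) \<le> exp (cmod \<zeta> * Y x) + exp (- cmod \<zeta> * Y x)" for n
        by (intro AE_I2 dom)
    qed measurable
    moreover have "(\<integral>x. (\<Sum>k<n. (\<zeta> * complex_of_real (Y x)) ^ k / fact k) \<partial>M) = (\<Sum>k<n. m k * (\<zeta> - 0) ^ k)" for n
    proof -
      have "(\<integral>x. (\<Sum>k<n. (\<zeta> * complex_of_real (Y x)) ^ k / fact k) \<partial>M)
          = (\<Sum>k<n. \<integral>x. (\<zeta> * complex_of_real (Y x)) ^ k / fact k \<partial>M)"
        by (rule Bochner_Integration.integral_sum) (rule intk)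
      also have "\<dots> = (\<Sum>k<n. m k * (\<zeta> - 0) ^ k)"
      proof (rule sum.cong[OF refl])
        fix k
        have "(\<integral>x. (\<zeta> * complex_of_real (Y x)) ^ k / fact k \<partial>M) = (\<integral>x. \<zeta> ^ k * (complex_of_real (Y x) ^ k / fact k) \<partial>M)"
          by (simp add: power_mult_distrib)
        also have "\<dots> = \<zeta> ^ k * m k" unfolding m_def by (rule integral_mult_right_zero)
        finally show "(\<integral>x. (\<zeta> * complex_of_real (Y x)) ^ k / fact k \<partial>M) = m k * (\<zeta> - 0) ^ k" by simp
      qed
      finally show ?thesis .
    qed
    ultimately show ?thesis by (simp add: sums_def)
  qed
  have hol: "F holomorphic_on ball 0 2"
    by (rule power_series_holomorphic) (rule sums)
  have real: "F (complex_of_real t) - exp ((complex_of_real t)\<^sup>2 * of_real s / 2) = 0" for t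
  proof -
    have "F (complex_of_real t) = (\<integral>x. complex_of_real (exp (t * Y x)) \<partial>M)"
      unfolding F_def by (intro Bochner_Integration.integral_cong refl) (simp add: exp_of_real[symmetric])
    also have "\<dots> = complex_of_real (exp (t\<^sup>2 * s / 2))" by (simp only: integral_complex_of_real mgf)
    finally show ?thesis by (simp add: exp_of_real[symmetric])
  qed
  \<comment> \<open>The disc of radius 2 contains the imaginary unit, and the real segment on which
    both sides agree accumulates at its centre 0.\<close>
  have "(\<lambda>\<zeta>. F \<zeta> - exp (\<zeta>\<^sup>2 * of_real s / 2)) \<i> = 0"
  proof (rule analytic_continuation[where f = "\<lambda>\<zeta>. F \<zeta> - exp (\<zeta>\<^sup>2 * of_real s / 2)" and w = \<i> and S = "ball 0 2" and U = "complex_of_real ` {0<..<1}" and \<xi> = 0])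
    show "(\<lambda>\<zeta>. F \<zeta> - exp (\<zeta>\<^sup>2 * of_real s / 2)) holomorphic_on ball 0 2"
      by (intro holomorphic_intros hol) simp_all
    show "(0::complex) islimpt complex_of_real ` {0<..<1}"
      unfolding islimpt_approachable
    proof (intro allI impI)
      fix e :: real assume "e > 0"
      then have "min (e / 2) (1 / 2) \<in> {0<..<1}" "min (e / 2) (1 / 2) < e" by auto
      then show "\<exists>x'\<in>complex_of_real ` {0<..<1}. x' \<noteq> 0 \<and> dist x' 0 < e"
        by (intro bexI[of _ "complex_of_real (min (e / 2) (1 / 2))"]) (auto simp: norm_of_real)
    qed
    show "\<zeta> \<in> complex_of_real ` {0<..<1} \<Longrightarrow> F \<zeta> - exp (\<zeta>\<^sup>2 * of_real s / 2) = 0" for \<zeta>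
      using real by auto
  qed auto
  moreover have "F \<i> = (\<integral>x. cis (Y x) \<partial>M)" by (simp add: F_def cis_conv_exp)
  ultimately show ?thesis by (simp add: exp_of_real[symmetric])
qed

lemma lebN_nontrivial: "\<not> (AE x in lebN N. False)"
proof
  let ?B = "PiE {..<N} (\<lambda>_. {0..1::real})"
  assume "AE x in lebN N. False"
  then have "emeasure (lebN N) (space (lebN N)) = 0"
    by (simp add: eventually_False ae_filter_eq_bot_iff[symmetric])
  moreover have "emeasure (lebN N) ?B \<le> emeasure (lebN N) (space (lebN N))"
    by (rule emeasure_space)
  moreover have "emeasure (lebN N) ?B = 1"
    by (subst lebesgue_coordinates.emeasure_PiM) auto
  ultimately show False by simp
qed

lemma integral_lebN_pos:
  fixes f :: "(nat \<Rightarrow> real) \<Rightarrow> real"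
  assumes f: "integrable (lebN N) f" and pos: "\<And>x. f x > 0"
  shows "(\<integral>x. f x \<partial>lebN N) > 0"
proof -
  have "(\<integral>x. f x \<partial>lebN N) \<noteq> 0"
  proof
    assume "(\<integral>x. f x \<partial>lebN N) = 0"
    then have "AE x in lebN N. f x = 0"
      using integral_nonneg_eq_0_iff_AE[OF f] pos by (simp add: less_imp_le)
    then have "AE x in lebN N. False"
      by eventually_elim (use pos in \<open>simp add: less_le\<close>)
    then show False using lebN_nontrivial by blast
  qed
  moreover have "(\<integral>x. f x \<partial>lebN N) \<ge> 0"
    using pos by (intro Bochner_Integration.integral_nonneg) (simp add: less_imp_le)
  ultimately show ?thesis by simp
qed

definition quad_form :: "nat \<Rightarrow> (nat \<Rightarrow> nat \<Rightarrow> real) \<Rightarrow> (nat \<Rightarrow> real) \<Rightarrow> real" where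
  "quad_form N S x = (\<Sum>i<N. \<Sum>j<N. x i * S i j * x j)"

text \<open>Kept as an integral: only its positivity and its invariance under translations are used,
  so the determinant of S does not enter.\<close>

definition gauss_Z :: "nat \<Rightarrow> (nat \<Rightarrow> nat \<Rightarrow> real) \<Rightarrow> real" where
  "gauss_Z N S = (\<integral>x. exp (- quad_form N S x / 2) \<partial>lebN N)"

definition gauss_law :: "nat \<Rightarrow> (nat \<Rightarrow> nat \<Rightarrow> real) \<Rightarrow> (nat \<Rightarrow> real) measure" where
  "gauss_law N S = density (lebN N) (\<lambda>x. ennreal (exp (- quad_form N S x / 2) / gauss_Z N S))"

lemma quad_form_measurable [measurable]: "quad_form N S \<in> borel_measurable (lebN N)"
  unfolding quad_form_def by measurable

context
  fixes N :: nat and S :: "nat \<Rightarrow> nat \<Rightarrow> real" and e :: real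
  assumes sym: "\<And>i j. S i j = S j i" and e: "e > 0"
    and coercive: "\<And>x. quad_form N S x \<ge> e * (\<Sum>i<N. (x i)\<^sup>2)"
begin

lemma gauss_shift_integrable: "integrable (lebN N) (\<lambda>x. exp (- quad_form N S (affN N 1 v x) / 2))"
proof (rule Bochner_Integration.integrable_bound)
  show "integrable (lebN N) (\<lambda>x. exp (- (e / 2) * (\<Sum>i<N. (x i - v i)\<^sup>2)))"
    using e by (intro integrable_gaussian_lebN) simp
  show "(\<lambda>x. exp (- quad_form N S (affN N 1 v x) / 2)) \<in> borel_measurable (lebN N)"
    by measurable
  show "AE x in lebN N. norm (exp (- quad_form N S (affN N 1 v x) / 2))
      \<le> norm (exp (- (e / 2) * (\<Sum>i<N. (x i - v i)\<^sup>2)))"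
  proof (rule AE_I2)
    fix x
    have "quad_form N S (affN N 1 v x) \<ge> e * (\<Sum>i<N. (x i - v i)\<^sup>2)"
      using coercive[of "affN N 1 v x"] by simp
    then show "norm (exp (- quad_form N S (affN N 1 v x) / 2)) \<le> norm (exp (- (e / 2) * (\<Sum>i<N. (x i - v i)\<^sup>2)))"
      by simp
  qed
qed

lemma gauss_integrable: "integrable (lebN N) (\<lambda>x. exp (- quad_form N S x / 2))"
  using gauss_shift_integrable[of "\<lambda>_. 0"] by (simp add: quad_form_def)

lemma gauss_Z_pos: "gauss_Z N S > 0"
  unfolding gauss_Z_def by (rule integral_lebN_pos[OF gauss_integrable]) simp

lemma quad_form_shift:
  "quad_form N S (affN N 1 v x) =
     quad_form N S x - 2 * (\<Sum>i<N. (\<Sum>j<N. S i j * v j) * x i) + quad_form N S v"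
proof -
  have "quad_form N S (affN N 1 v x) =
    (\<Sum>i<N. \<Sum>j<N. x i * S i j * x j - S i j * v j * x i - v i * S i j * x j + v i * S i j * v j)"
    unfolding quad_form_def by (intro sum.cong refl) (simp add: algebra_simps)
  also have "\<dots> = quad_form N S x - (\<Sum>i<N. \<Sum>j<N. S i j * v j * x i)
      - (\<Sum>i<N. \<Sum>j<N. v i * S i j * x j) + quad_form N S v"
    by (simp add: quad_form_def sum.distrib sum_subtractf)
  also have "(\<Sum>i<N. \<Sum>j<N. v i * S i j * x j) = (\<Sum>i<N. \<Sum>j<N. S i j * v j * x i)"
    by (subst sum.swap) (intro sum.cong refl, simp add: sym mult_ac)
  finally show ?thesis unfolding sum_distrib_right by linarith
qed

text \<open>Completing the square with S v = u turns the tilted density into the density translated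
  by v, and Lebesgue measure is translation invariant.\<close>

lemma gauss_mgf:
  assumes u: "\<And>i. i < N \<Longrightarrow> (\<Sum>j<N. S i j * v j) = u i"
  shows "integrable (gauss_law N S) (\<lambda>x. exp (\<Sum>i<N. u i * x i))"
    and "(\<integral>x. exp (\<Sum>i<N. u i * x i) \<partial>gauss_law N S) = exp (quad_form N S v / 2)"
proof -
  define Z where "Z = gauss_Z N S"
  have Z: "Z > 0" using gauss_Z_pos by (simp add: Z_def)
  have shift: "exp (- quad_form N S x / 2) / Z * exp (\<Sum>i<N. u i * x i) =
     exp (quad_form N S v / 2) / Z * exp (- quad_form N S (affN N 1 v x) / 2)" for x
  proof -
    have "(\<Sum>i<N. (\<Sum>j<N. S i j * v j) * x i) = (\<Sum>i<N. u i * x i)"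
      using u by (intro sum.cong) auto
    then have "- quad_form N S x / 2 + (\<Sum>i<N. u i * x i) =
        quad_form N S v / 2 + - quad_form N S (affN N 1 v x) / 2"
      using quad_form_shift[of x v] by linarith
    then have "exp (- quad_form N S x / 2) * exp (\<Sum>i<N. u i * x i) =
        exp (quad_form N S v / 2) * exp (- quad_form N S (affN N 1 v x) / 2)"
      by (simp only: exp_add[symmetric])
    then show ?thesis by (simp only: times_divide_eq_left)
  qed
  have m: "(\<lambda>x. exp (\<Sum>i<N. u i * x i)) \<in> borel_measurable (lebN N)"
    "(\<lambda>x. exp (- quad_form N S x / 2) / Z) \<in> borel_measurable (lebN N)"
    by measurable
  have "integrable (lebN N) (\<lambda>x. (exp (- quad_form N S x / 2) / Z) *\<^sub>R exp (\<Sum>i<N. u i * x i))"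
    unfolding real_scaleR_def shift by (intro integrable_mult_right gauss_shift_integrable)
  then show "integrable (gauss_law N S) (\<lambda>x. exp (\<Sum>i<N. u i * x i))"
    unfolding gauss_law_def Z_def[symmetric] using m Z by (subst integrable_density) simp_all
  have "(\<integral>x. exp (\<Sum>i<N. u i * x i) \<partial>gauss_law N S) =
    (\<integral>x. (exp (- quad_form N S x / 2) / Z) *\<^sub>R exp (\<Sum>i<N. u i * x i) \<partial>lebN N)"
    unfolding gauss_law_def Z_def[symmetric] using m Z by (subst integral_density) simp_all
  also have "\<dots> = (\<integral>x. exp (quad_form N S v / 2) / Z * exp (- quad_form N S (affN N 1 v x) / 2) \<partial>lebN N)"
    by (simp only: real_scaleR_def shift)
  also have "\<dots> = exp (quad_form N S v / 2) / Z * (\<integral>x. exp (- quad_form N S (affN N 1 v x) / 2) \<partial>lebN N)"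
    by (rule integral_mult_right_zero)
  also have "(\<integral>x. exp (- quad_form N S (affN N 1 v x) / 2) \<partial>lebN N) = Z"
    unfolding Z_def gauss_Z_def
    using integral_lebN_affine[of 1 "\<lambda>x. exp (- quad_form N S x / 2)" N v] by simp
  finally show "(\<integral>x. exp (\<Sum>i<N. u i * x i) \<partial>gauss_law N S) = exp (quad_form N S v / 2)"
    using Z by simp
qed

lemma gauss_law_prob: "prob_space (gauss_law N S)"
proof
  have "emeasure (gauss_law N S) (space (gauss_law N S)) =
    (\<integral>\<^sup>+x. ennreal (exp (- quad_form N S x / 2) / gauss_Z N S) \<partial>lebN N)"
    unfolding gauss_law_def by (subst emeasure_density) (auto intro!: nn_integral_cong)
  also have "\<dots> = ennreal (\<integral>x. exp (- quad_form N S x / 2) / gauss_Z N S \<partial>lebN N)"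
    using gauss_integrable gauss_Z_pos by (intro nn_integral_eq_integral) auto
  also have "\<dots> = 1"
    using gauss_Z_pos by (simp add: gauss_Z_def)
  finally show "emeasure (gauss_law N S) (space (gauss_law N S)) = 1" .
qed

lemma gauss_law_centered_normal:
  assumes inv: "\<And>i k. i < N \<Longrightarrow> k < N \<Longrightarrow> (\<Sum>j<N. S i j * Cov $$ (j, k)) = (if i = k then 1 else 0)"
  shows "centered_normal N Cov (gauss_law N S)"
  unfolding centered_normal_def
proof (intro conjI allI)
  show "prob_space (gauss_law N S)" by (rule gauss_law_prob)
  show "sets (gauss_law N S) = sets (lebN N)" by (simp add: gauss_law_def)
  fix u :: "nat \<Rightarrow> real"
  \<comment> \<open>v = Cov u solves S v = u, so the value of the form of S at v is that of Cov at
    u.\<close>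
  define v where "v j = (\<Sum>k<N. Cov $$ (j, k) * u k)" for j
  have Sv: "(\<Sum>j<N. S i j * v j) = u i" if "i < N" for i
  proof -
    have "(\<Sum>j<N. S i j * v j) = (\<Sum>k<N. (\<Sum>j<N. S i j * Cov $$ (j, k)) * u k)"
      unfolding v_def sum_distrib_left sum_distrib_right
      by (subst sum.swap) (simp add: mult_ac)
    also have "\<dots> = (\<Sum>k<N. if i = k then u k else 0)"
      using inv that by (intro sum.cong) auto
    finally show ?thesis using that by simp
  qed
  have q: "quad_form N S v = (\<Sum>i<N. \<Sum>j<N. u i * Cov $$ (i, j) * u j)"
  proof -
    have "quad_form N S v = (\<Sum>i<N. v i * (\<Sum>j<N. S i j * v j))"
      by (simp add: quad_form_def sum_distrib_left mult_ac)
    also have "\<dots> = (\<Sum>i<N. u i * v i)" using Sv by (intro sum.cong) auto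
    finally show ?thesis by (simp add: v_def sum_distrib_left mult_ac)
  qed
  have scale: "(\<Sum>j<N. S i j * (t * v j)) = t * u i" if "i < N" for i t
    using Sv[OF that] by (simp add: sum_distrib_left[symmetric] mult.left_commute)
  have "(\<integral>x. cis (\<Sum>i<N. u i * x i) \<partial>gauss_law N S) = complex_of_real (exp (- quad_form N S v / 2))"
  proof (rule gaussian_mgf_imp_char[OF gauss_law_prob])
    show "(\<lambda>x. \<Sum>i<N. u i * x i) \<in> borel_measurable (gauss_law N S)"
      unfolding gauss_law_def by simp
    fix t :: real
    have tu: "t * (\<Sum>i<N. u i * x i) = (\<Sum>i<N. (t * u i) * x i)" for x :: "nat \<Rightarrow> real"
      by (simp add: sum_distrib_left mult_ac)
    have tq: "quad_form N S (\<lambda>j. t * v j) = t\<^sup>2 * quad_form N S v"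
      by (simp add: quad_form_def sum_distrib_left power2_eq_square mult_ac)
    show "integrable (gauss_law N S) (\<lambda>x. exp (t * (\<Sum>i<N. u i * x i)))"
      unfolding tu by (rule gauss_mgf(1)[OF scale])
    show "(\<integral>x. exp (t * (\<Sum>i<N. u i * x i)) \<partial>gauss_law N S) = exp (t\<^sup>2 * quad_form N S v / 2)"
      unfolding tu tq[symmetric] by (rule gauss_mgf(2)[OF scale])
  qed
  then show "(\<integral>x. cis (\<Sum>i<N. u i * x i) \<partial>gauss_law N S) =
      complex_of_real (exp (- (\<Sum>i<N. \<Sum>j<N. u i * Cov $$ (i, j) * u j) / 2))"
    unfolding q .
qed

end

section \<open>Laplace's method\<close>

text \<open>The topology on functions involves all coordinates, the measure only those below N. On
  extensional functions the other coordinates are constantly \<open>undefined\<close>, hence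
  measurable. This makes the continuous test functions of \<open>conv_distr\<close>
  measurable.\<close>

lemma lebN_id_measurable_borel: "(\<lambda>x. x) \<in> measurable (lebN N) (borel :: (nat \<Rightarrow> real) measure)"
proof -
  have "(\<lambda>x. x) \<in> measurable (lebN N) (PiM UNIV (\<lambda>_. borel :: real measure))"
  proof (rule measurable_PiM_single')
    fix i :: nat
    show "(\<lambda>x. x i) \<in> borel_measurable (lebN N)"
    proof (cases "i < N")
      case False
      then have "(\<lambda>x. x i) \<in> borel_measurable (lebN N) \<longleftrightarrow> (\<lambda>x. undefined :: real) \<in> borel_measurable (lebN N)"
        by (intro measurable_cong) (auto simp: space_PiM PiE_iff extensional_def)
      then show ?thesis by simp
    qed simp
  qed (simp add: space_PiM)
  then show ?thesis using measurable_cong_sets[OF refl sets_PiM_equal_borel] by blast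
qed

lemma continuous_on_RN_measurable:
  fixes f :: "(nat \<Rightarrow> real) \<Rightarrow> real"
  assumes "continuous_on (RN N) f"
  shows "f \<in> borel_measurable (lebN N)"
proof -
  have "(\<lambda>x. x) \<in> measurable (lebN N) (restrict_space (borel :: (nat \<Rightarrow> real) measure) (RN N))"
    by (intro measurable_restrict_space2 lebN_id_measurable_borel) (auto simp: space_PiM)
  from measurable_compose[OF this borel_measurable_continuous_on_restrict[OF assms]]
  show ?thesis .
qed

text \<open>Laplace's method: after rescaling by \<open>sqrt \<kappa>\<close> around \<open>w\<close> the densities, normalised to be 1
  at the origin, are dominated by a fixed Gaussian and converge pointwise.\<close>

lemma laplace_conv_distr:
  fixes C :: "(nat \<Rightarrow> real) set" and dens :: "real \<Rightarrow> (nat \<Rightarrow> real) \<Rightarrow> real" and D :: "real \<Rightarrow> real"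
    and S :: "nat \<Rightarrow> nat \<Rightarrow> real" and w :: "nat \<Rightarrow> real" and e :: real
  assumes meas: "\<And>\<kappa>. (\<lambda>t. indicator C t * dens \<kappa> t) \<in> borel_measurable (lebN N)"
    and nonneg: "\<And>\<kappa> t. \<kappa> > 0 \<Longrightarrow> t \<in> C \<Longrightarrow> dens \<kappa> t \<ge> 0"
    and e: "e > 0" and D: "\<And>\<kappa>. \<kappa> > 0 \<Longrightarrow> D \<kappa> > 0"
    and bound: "\<And>\<kappa> t. \<kappa> > 0 \<Longrightarrow> t \<in> C \<Longrightarrow> dens \<kappa> t \<le> D \<kappa> * exp (- \<kappa> * e * (\<Sum>i<N. (t i - w i)\<^sup>2))"
    and lim: "\<And>x. x \<in> RN N \<Longrightarrow> ((\<lambda>\<kappa>. indicator C (\<lambda>i\<in>{..<N}. w i + x i / sqrt \<kappa>)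
        * dens \<kappa> (\<lambda>i\<in>{..<N}. w i + x i / sqrt \<kappa>) / D \<kappa>) \<longlongrightarrow> exp (- quad_form N S x / 2)) at_top"
    and Zpos: "gauss_Z N S > 0"
  shows "conv_distr N (\<lambda>\<kappa>. distr (density (lebN N) (\<lambda>t. indicator C t * ennreal (dens \<kappa> t) /
          (\<integral>\<^sup>+ s. indicator C s * ennreal (dens \<kappa> s) \<partial>lebN N))) (lebN N) (affN N (sqrt \<kappa>) w)) (gauss_law N S)"
  unfolding conv_distr_def
proof (intro allI impI)
  fix f :: "(nat \<Rightarrow> real) \<Rightarrow> real"
  assume f: "continuous_on (RN N) f \<and> bounded (f ` RN N)"
  have fm [measurable]: "f \<in> borel_measurable (lebN N)" using f continuous_on_RN_measurable by blast
  obtain B where B: "\<And>x. x \<in> RN N \<Longrightarrow> \<bar>f x\<bar> \<le> B" using f unfolding bounded_iff by auto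
  have sp: "space (lebN N) = RN N" by (simp add: space_PiM)
  define g where "g \<kappa> t = indicator C t * dens \<kappa> t" for \<kappa> t
  \<comment> \<open>The inverse on \<open>RN N\<close> of the centring and rescaling map; r below is
    the rescaled density divided by D \<kappa>.\<close>
  define iv where "iv \<kappa> x = (\<lambda>i\<in>{..<N}. w i + x i / sqrt \<kappa>)" for \<kappa> and x :: "nat \<Rightarrow> real"
  define r where "r \<kappa> x = g \<kappa> (iv \<kappa> x) / D \<kappa>" for \<kappa> x
  have gm [measurable]: "g \<kappa> \<in> borel_measurable (lebN N)" for \<kappa>
    unfolding g_def by (rule meas)
  have iv [measurable]: "iv \<kappa> \<in> measurable (lebN N) (lebN N)" for \<kappa>
    unfolding iv_def by measurable
  have rm [measurable]: "r \<kappa> \<in> borel_measurable (lebN N)" for \<kappa>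
    unfolding r_def by measurable
  have g0: "0 \<le> g \<kappa> t" if "\<kappa> > 0" for \<kappa> t
    using nonneg[OF that] by (auto simp: g_def indicator_def)
  have gb: "g \<kappa> t \<le> D \<kappa> * exp (- (\<kappa> * e) * (\<Sum>i<N. (t i - w i)\<^sup>2))" if "\<kappa> > 0" for \<kappa> t
    using bound[OF that] D[OF that] by (auto simp: g_def indicator_def less_imp_le)
  have r0: "0 \<le> r \<kappa> x" if "\<kappa> > 0" for \<kappa> x
    unfolding r_def using g0[OF that] D[OF that] by simp
  have rb: "r \<kappa> x \<le> exp (- e * (\<Sum>i<N. (x i - 0)\<^sup>2))" if k: "\<kappa> > 0" for \<kappa> x
  proof -
    have "(\<Sum>i<N. (iv \<kappa> x i - w i)\<^sup>2) = (\<Sum>i<N. (x i)\<^sup>2) / \<kappa>"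
      unfolding sum_divide_distrib using k by (intro sum.cong) (auto simp: iv_def power_divide)
    then have "g \<kappa> (iv \<kappa> x) \<le> D \<kappa> * exp (- e * (\<Sum>i<N. (x i)\<^sup>2))"
      using gb[OF k, of "iv \<kappa> x"] k by simp
    then show ?thesis unfolding r_def using D[OF k] by (simp add: field_simps)
  qed
  have gi: "integrable (lebN N) (g \<kappa>)" if k: "\<kappa> > 0" for \<kappa>
  proof (rule Bochner_Integration.integrable_bound)
    show "integrable (lebN N) (\<lambda>t. D \<kappa> * exp (- (\<kappa> * e) * (\<Sum>i<N. (t i - w i)\<^sup>2)))"
      using k e by (intro integrable_mult_right integrable_gaussian_lebN) simp
    show "AE t in lebN N. norm (g \<kappa> t) \<le> norm (D \<kappa> * exp (- (\<kappa> * e) * (\<Sum>i<N. (t i - w i)\<^sup>2)))"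
    proof (rule AE_I2)
      fix t
      show "norm (g \<kappa> t) \<le> norm (D \<kappa> * exp (- (\<kappa> * e) * (\<Sum>i<N. (t i - w i)\<^sup>2)))"
        using g0[OF k, of t] gb[OF k, of t] by simp
    qed
  qed simp
  \<comment> \<open>Used twice: with F = 1 for the normalising integral and with F = f for the
    numerator.\<close>
  have dct: "((\<lambda>\<kappa>. \<integral>x. F x * r \<kappa> x \<partial>lebN N) \<longlongrightarrow> (\<integral>x. F x * exp (- quad_form N S x / 2) \<partial>lebN N)) at_top"
    if [measurable]: "F \<in> borel_measurable (lebN N)" and Fb: "\<And>x. x \<in> RN N \<Longrightarrow> \<bar>F x\<bar> \<le> K" for F :: "(nat \<Rightarrow> real) \<Rightarrow> real" and K
  proof (rule integral_dominated_convergence_at_top[where w = "\<lambda>x. K * exp (- e * (\<Sum>i<N. (x i - 0)\<^sup>2))"])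
    show "integrable (lebN N) (\<lambda>x. K * exp (- e * (\<Sum>i<N. (x i - 0)\<^sup>2)))"
      using e by (intro integrable_mult_right integrable_gaussian_lebN) simp
    show "AE x in lebN N. ((\<lambda>\<kappa>. F x * r \<kappa> x) \<longlongrightarrow> F x * exp (- quad_form N S x / 2)) at_top"
      using lim unfolding r_def g_def iv_def by (intro AE_I2 tendsto_intros) (simp add: sp)
    show "\<forall>\<^sub>F \<kappa> in at_top. AE x in lebN N. norm (F x * r \<kappa> x) \<le> K * exp (- e * (\<Sum>i<N. (x i - 0)\<^sup>2))"
      using eventually_gt_at_top[of 0]
    proof eventually_elim
      case (elim \<kappa>)
      show ?case
      proof (rule AE_I2)
        fix x assume "x \<in> space (lebN N)"
        then have "\<bar>F x\<bar> \<le> K" using Fb by (simp add: sp)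
        then show "norm (F x * r \<kappa> x) \<le> K * exp (- e * (\<Sum>i<N. (x i - 0)\<^sup>2))"
          using rb[OF elim, of x] r0[OF elim, of x] by (auto simp: abs_mult intro!: mult_mono)
      qed
    qed
  qed measurable
  have lim1: "((\<lambda>\<kappa>. \<integral>x. r \<kappa> x \<partial>lebN N) \<longlongrightarrow> gauss_Z N S) at_top"
    using dct[of "\<lambda>_. 1" 1] by (simp add: gauss_Z_def)
  have limf: "((\<lambda>\<kappa>. \<integral>x. f x * r \<kappa> x \<partial>lebN N) \<longlongrightarrow> (\<integral>x. f x * exp (- quad_form N S x / 2) \<partial>lebN N)) at_top"
    using dct[OF fm B] .
  have nu: "(\<integral>x. f x \<partial>gauss_law N S) = (\<integral>x. f x * exp (- quad_form N S x / 2) \<partial>lebN N) / gauss_Z N S"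
    unfolding gauss_law_def using Zpos by (subst integral_density) (auto simp: mult.commute)
  have "((\<lambda>\<kappa>. (\<integral>x. f x * r \<kappa> x \<partial>lebN N) / (\<integral>x. r \<kappa> x \<partial>lebN N)) \<longlongrightarrow> (\<integral>x. f x \<partial>gauss_law N S)) at_top"
    unfolding nu using Zpos by (intro tendsto_divide limf lim1) simp
  moreover have "\<forall>\<^sub>F \<kappa> in at_top. (\<integral>x. f x * r \<kappa> x \<partial>lebN N) / (\<integral>x. r \<kappa> x \<partial>lebN N) =
     (\<integral>x. f x \<partial>distr (density (lebN N) (\<lambda>t. indicator C t * ennreal (dens \<kappa> t) /
          (\<integral>\<^sup>+ s. indicator C s * ennreal (dens \<kappa> s) \<partial>lebN N))) (lebN N) (affN N (sqrt \<kappa>) w))"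
    \<comment> \<open>Convergence to a positive limit makes the normalising integral eventually
      positive; then D \<kappa> and the Jacobian cancel in the quotient.\<close>
    using eventually_gt_at_top[of 0] order_tendstoD(1)[OF lim1 Zpos]
  proof eventually_elim
    case (elim \<kappa>)
    define c where "c = sqrt \<kappa>"
    have c: "c > 0" using elim by (simp add: c_def)
    define G where "G = (\<integral>t. g \<kappa> t \<partial>lebN N)"
    have ivT: "iv \<kappa> (affN N c w t) = t" if "t \<in> RN N" for t
      using that c by (auto simp: iv_def c_def[symmetric] PiE_iff extensional_def fun_eq_iff)
    have gr: "g \<kappa> t = D \<kappa> * r \<kappa> (affN N c w t)" if "t \<in> RN N" for t
      using D[OF elim(1)] by (simp add: r_def ivT[OF that])
    have subs: "(\<integral>t. F (affN N c w t) * g \<kappa> t \<partial>lebN N) = D \<kappa> / c ^ N * (\<integral>x. F x * r \<kappa> x \<partial>lebN N)"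
      if [measurable]: "F \<in> borel_measurable (lebN N)" for F :: "(nat \<Rightarrow> real) \<Rightarrow> real"
    proof -
      have "(\<integral>t. F (affN N c w t) * g \<kappa> t \<partial>lebN N)
        = (\<integral>t. D \<kappa> * (F (affN N c w t) * r \<kappa> (affN N c w t)) \<partial>lebN N)"
        by (intro Bochner_Integration.integral_cong refl) (simp add: gr sp)
      also have "\<dots> = D \<kappa> * (\<integral>t. F (affN N c w t) * r \<kappa> (affN N c w t) \<partial>lebN N)"
        by (rule integral_mult_right_zero)
      also have "(\<integral>t. F (affN N c w t) * r \<kappa> (affN N c w t) \<partial>lebN N) = (\<integral>x. F x * r \<kappa> x \<partial>lebN N) / c ^ N"
        using integral_lebN_affine[OF c, of "\<lambda>x. F x * r \<kappa> x" N w] c by simp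
      finally show ?thesis by (simp only: times_divide_eq_right times_divide_eq_left)
    qed
    have Gr: "G = D \<kappa> / c ^ N * (\<integral>x. r \<kappa> x \<partial>lebN N)"
      using subs[of "\<lambda>_. 1"] by (simp add: G_def)
    have Gpos: "G > 0" unfolding Gr using D[OF elim(1)] c elim(2) by simp
    have ig: "indicator C t * ennreal (dens \<kappa> t) = ennreal (g \<kappa> t)" for t
      by (auto simp: g_def indicator_def)
    have "(\<integral>\<^sup>+ s. indicator C s * ennreal (dens \<kappa> s) \<partial>lebN N) = ennreal G"
      unfolding ig G_def using gi[OF elim(1)] g0[OF elim(1)] by (intro nn_integral_eq_integral) auto
    then have law: "(\<lambda>t. indicator C t * ennreal (dens \<kappa> t) / (\<integral>\<^sup>+ s. indicator C s * ennreal (dens \<kappa> s) \<partial>lebN N))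
       = (\<lambda>t. ennreal (g \<kappa> t / G))"
      using Gpos g0[OF elim(1)] by (simp only: ig divide_ennreal)
    have "(\<integral>x. f x \<partial>distr (density (lebN N) (\<lambda>t. ennreal (g \<kappa> t / G))) (lebN N) (affN N c w))
      = (\<integral>t. f (affN N c w t) \<partial>density (lebN N) (\<lambda>t. ennreal (g \<kappa> t / G)))"
      by (subst integral_distr) auto
    also have "\<dots> = (\<integral>t. (g \<kappa> t / G) *\<^sub>R f (affN N c w t) \<partial>lebN N)"
      using Gpos g0[OF elim(1)] by (subst integral_density) auto
    also have "\<dots> = (\<integral>t. f (affN N c w t) * g \<kappa> t \<partial>lebN N) / G"
      by (simp add: mult.commute)
    also have "\<dots> = (\<integral>x. f x * r \<kappa> x \<partial>lebN N) / (\<integral>x. r \<kappa> x \<partial>lebN N)"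
      unfolding subs[OF fm] Gr using D[OF elim(1)] c by simp
    finally show ?case unfolding law c_def by simp
  qed
  ultimately show "((\<lambda>\<kappa>. \<integral>x. f x \<partial>distr (density (lebN N) (\<lambda>t. indicator C t * ennreal (dens \<kappa> t) /
          (\<integral>\<^sup>+ s. indicator C s * ennreal (dens \<kappa> s) \<partial>lebN N))) (lebN N) (affN N (sqrt \<kappa>) w))
        \<longlongrightarrow> (\<integral>x. f x \<partial>gauss_law N S)) at_top"
    by (rule Lim_transform_eventually)
qed

section \<open>The trigonometric density near its maximum\<close>

lemma has_derivative_ln_sin:
  assumes "0 < x" "x < pi"
  shows "((\<lambda>y. ln (sin y)) has_real_derivative cot x) (at x)"
  using sin_gt_zero[OF assms] by (auto intro!: derivative_eq_intros simp: cot_def)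

lemma has_derivative_cot:
  assumes "0 < x" "x < pi"
  shows "(cot has_real_derivative - 1 / (sin x)\<^sup>2) (at x)"
  using DERIV_cot[of x] sin_gt_zero[OF assms] by (simp add: inverse_eq_divide)

text \<open>The second derivative of - ln (sin y) - y^2 / 2 is 1 / sin^2 - 1 >= 0, so this function
  lies above its tangent at s; the quadratic terms combine to (y - s)^2 / 2.\<close>

lemma ln_sin_tangent:
  assumes s: "0 < s" "s < pi" and y: "0 < y" "y < pi"
  shows "ln (sin y) \<le> ln (sin s) + cot s * (y - s) - (y - s)\<^sup>2 / 2"
proof -
  let ?f = "\<lambda>y. - ln (sin y) - y\<^sup>2 / 2"
  have d1: "(?f has_real_derivative (- cot x - x)) (at x)" if "x \<in> {0<..<pi}" for x
    using that by (auto intro!: derivative_eq_intros simp: sin_gt_zero cot_def)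
  have "convex_on {0<..<pi} ?f"
  proof (rule f''_ge0_imp_convex)
    show "((\<lambda>x. - cot x - x) has_real_derivative (1 / (sin x)\<^sup>2 - 1)) (at x)" if "x \<in> {0<..<pi}" for x
      using that by (auto intro!: derivative_eq_intros has_derivative_cot)
    show "1 / (sin x)\<^sup>2 - 1 \<ge> 0" if "x \<in> {0<..<pi}" for x
      using that sin_gt_zero[of x] by (simp add: power_le_one_iff)
  qed (use d1 in auto)
  then have "?f y - ?f s \<ge> (- cot s - s) * (y - s)"
    by (rule convex_on_imp_above_tangent) (use s y d1[of s] in \<open>auto simp: interior_open intro: DERIV_subset\<close>)
  then show ?thesis by (simp add: algebra_simps power2_eq_square diff_divide_distrib add_divide_distrib)
qed

text \<open>Taylor's formula with Peano remainder along v = h / sqrt \<kappa>, where \<kappa> = h^2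
  / v^2. One application of l'Hopital's rule reduces it to the difference quotient of f' at
  s.\<close>

lemma second_order_expansion:
  fixes f f' :: "real \<Rightarrow> real"
  assumes f: "\<forall>\<^sub>F x in nhds s. (f has_real_derivative f' x) (at x)"
    and f': "(f' has_real_derivative f'') (at s)"
  shows "((\<lambda>\<kappa>. \<kappa> * (f (s + h / sqrt \<kappa>) - f s - f' s * (h / sqrt \<kappa>))) \<longlongrightarrow> f'' * h\<^sup>2 / 2) at_top"
\<comment> \<open>The substitution must avoid v = 0, so h = 0 is treated apart.\<close>
proof (cases "h = 0")
  case False
  have fd: "(f has_real_derivative f' s) (at s)" using eventually_nhds_x_imp_x[OF f] .
  have sh: "filterlim (\<lambda>v. s + v) (nhds s) (at (0::real))"
    by (auto intro!: tendsto_eq_intros)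
  have "((\<lambda>v. (f (s + v) - f s - f' s * v) / v\<^sup>2) \<longlongrightarrow> f'' / 2) (at 0)"
  proof (rule lhopital[where f' = "\<lambda>v. f' (s + v) - f' s" and g' = "\<lambda>v. 2 * v"])
    have "((\<lambda>v. f (s + v)) \<longlongrightarrow> f s) (at 0)"
      using isCont_tendsto_compose[OF DERIV_isCont[OF fd] sh] .
    then show "((\<lambda>v. f (s + v) - f s - f' s * v) \<longlongrightarrow> 0) (at 0)"
      by (auto intro!: tendsto_eq_intros)
    show "((\<lambda>v. v\<^sup>2) \<longlongrightarrow> 0) (at (0::real))" by (auto intro!: tendsto_eq_intros)
    show "\<forall>\<^sub>F v in at (0::real). v\<^sup>2 \<noteq> 0" "\<forall>\<^sub>F v in at (0::real). 2 * v \<noteq> 0"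
      by (auto simp: eventually_at_filter)
    show "\<forall>\<^sub>F v in at 0. ((\<lambda>v. f (s + v) - f s - f' s * v) has_real_derivative f' (s + v) - f' s) (at v)"
      using eventually_compose_filterlim[OF f sh]
    proof eventually_elim
      case (elim v)
      have "((\<lambda>v. f (s + v)) has_real_derivative f' (s + v)) (at v)"
        using DERIV_shift[of f "f' (s + v)" v s] elim by (simp add: add.commute)
      then show ?case by (auto intro!: derivative_eq_intros)
    qed
    show "\<forall>\<^sub>F v in at 0. ((\<lambda>v. v\<^sup>2) has_real_derivative 2 * v) (at v)"
      by (intro always_eventually allI) (auto intro!: derivative_eq_intros)
    have "((\<lambda>v. (f' (s + v) - f' s) / v / 2) \<longlongrightarrow> f'' / 2) (at 0)"
      using f' unfolding DERIV_def by (intro tendsto_divide) auto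
    then show "((\<lambda>v. (f' (s + v) - f' s) / (2 * v)) \<longlongrightarrow> f'' / 2) (at 0)"
      by (simp add: field_simps)
  qed
  moreover have "filterlim (\<lambda>\<kappa>. h / sqrt \<kappa>) (at 0) at_top"
  proof (rule filterlim_atI)
    show "((\<lambda>\<kappa>. h / sqrt \<kappa>) \<longlongrightarrow> 0) at_top"
      by (intro tendsto_divide_0[OF tendsto_const] filterlim_at_top_imp_at_infinity sqrt_at_top)
    show "\<forall>\<^sub>F \<kappa> in at_top. h / sqrt \<kappa> \<noteq> 0"
      using eventually_gt_at_top[of 0] by eventually_elim (use False in simp)
  qed
  ultimately have "((\<lambda>\<kappa>. (f (s + h / sqrt \<kappa>) - f s - f' s * (h / sqrt \<kappa>)) / (h / sqrt \<kappa>)\<^sup>2) \<longlongrightarrow> f'' / 2) at_top"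
    by (rule filterlim_compose)
  then have "((\<lambda>\<kappa>. h\<^sup>2 * ((f (s + h / sqrt \<kappa>) - f s - f' s * (h / sqrt \<kappa>)) / (h / sqrt \<kappa>)\<^sup>2)) \<longlongrightarrow> h\<^sup>2 * (f'' / 2)) at_top"
    by (rule tendsto_mult_left)
  moreover have "\<forall>\<^sub>F \<kappa> in at_top. h\<^sup>2 * ((f (s + h / sqrt \<kappa>) - f s - f' s * (h / sqrt \<kappa>)) / (h / sqrt \<kappa>)\<^sup>2)
     = \<kappa> * (f (s + h / sqrt \<kappa>) - f s - f' s * (h / sqrt \<kappa>))"
    using eventually_gt_at_top[of 0] by eventually_elim (use False in \<open>simp add: power_divide\<close>)
  ultimately show ?thesis by (subst (asm) tendsto_cong) (auto simp: mult.commute)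
qed simp

lemma ln_sin_second_order:
  assumes "0 < s" "s < pi"
  shows "((\<lambda>\<kappa>. \<kappa> * (ln (sin (s + h / sqrt \<kappa>)) - ln (sin s) - cot s * (h / sqrt \<kappa>))) \<longlongrightarrow> - h\<^sup>2 / (2 * (sin s)\<^sup>2)) at_top"
proof -
  have "((\<lambda>\<kappa>. \<kappa> * (ln (sin (s + h / sqrt \<kappa>)) - ln (sin s) - cot s * (h / sqrt \<kappa>))) \<longlongrightarrow> (- 1 / (sin s)\<^sup>2) * h\<^sup>2 / 2) at_top"
  proof (rule second_order_expansion[where f = "\<lambda>y. ln (sin y)" and f' = cot])
    have "\<forall>\<^sub>F x in nhds s. x \<in> {0<..<pi}"
      using assms by (intro eventually_nhds_in_open) auto
    then show "\<forall>\<^sub>F x in nhds s. ((\<lambda>y. ln (sin y)) has_real_derivative cot x) (at x)"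
      by eventually_elim (auto intro: has_derivative_ln_sin)
  qed (rule has_derivative_cot[OF assms])
  then show ?thesis by (simp add: mult.commute)
qed

section \<open>Powers of sines and their product over the positive roots\<close>

lemma rpow_nonneg: "rpow x y \<ge> 0"
  by (simp add: rpow_def)

lemma rpow_pos: "x > 0 \<Longrightarrow> rpow x y = exp (y * ln x)"
  by (simp add: rpow_def powr_def)

lemma rpow_mult: "x \<ge> 0 \<Longrightarrow> y \<ge> 0 \<Longrightarrow> rpow (x * y) p = rpow x p * rpow y p"
  by (simp add: rpow_def powr_mult)

text \<open>The exponentiated tangent bound. At the endpoints, where the logarithm is of no use, the
  left side is 0, or both sides are 1 when p = 0 by the convention in \<open>rpow\<close>.\<close>

lemma rpow_sin_bound:
  assumes s: "0 < s" "s < pi" and y: "0 \<le> y" "y \<le> pi" and p: "p \<ge> 0"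
  shows "rpow (sin y) p \<le> rpow (sin s) p * exp (p * (cot s * (y - s) - (y - s)\<^sup>2 / 2))"
proof (cases "y = 0 \<or> y = pi")
  case True
  then have "sin y = 0" by auto
  then show ?thesis by (cases "p = 0") (auto simp: rpow_def)
next
  case False
  then have y': "0 < y" "y < pi" using y by auto
  have "p * ln (sin y) \<le> p * (ln (sin s) + cot s * (y - s) - (y - s)\<^sup>2 / 2)"
    using ln_sin_tangent[OF s y'] p by (rule mult_left_mono)
  also have "\<dots> = p * ln (sin s) + p * (cot s * (y - s) - (y - s)\<^sup>2 / 2)"
    by (simp add: algebra_simps)
  finally show ?thesis
    using sin_gt_zero[OF s] sin_gt_zero[OF y'] by (simp add: rpow_pos exp_add[symmetric])
qed

text \<open>The forms below are the positive roots of type \<open>BC\<close> with multiplicities. Up to a factor depending only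
  on \<open>\<kappa>\<close>, the density is the product of the powers of their sines, because
  \<open>cos (2 * t j) - cos (2 * t i) = 2 * sin (t i + t j) * sin (t i - t j)\<close>.\<close>

definition root_idx :: "nat \<Rightarrow> (nat \<times> nat \<times> bool) set" where
  "root_idx N = (SIGMA j:{..<N}. {..j} \<times> UNIV)"

text \<open>Off the diagonal the flag chooses between sum and difference. For i = j the sum is 2
  t_j, and the slot of the vanishing difference is reused for t_j.\<close>

fun root_form :: "nat \<times> nat \<times> bool \<Rightarrow> (nat \<Rightarrow> real) \<Rightarrow> real" where
  "root_form (j, i, s) t = (if i = j then (if s then 2 * t j else t j) else (if s then t i + t j else t i - t j))"

fun root_mult :: "real \<Rightarrow> real \<Rightarrow> nat \<times> nat \<times> bool \<Rightarrow> real" where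
  "root_mult a b (j, i, s) = (if i = j then (if s then b else a) else 1)"

lemma finite_root_idx [simp]: "finite (root_idx N)"
  by (simp add: root_idx_def)

lemma sum_root_idx:
  fixes g :: "nat \<times> nat \<times> bool \<Rightarrow> real"
  shows "(\<Sum>m\<in>root_idx N. g m) =
    (\<Sum>j<N. \<Sum>i<j. g (j, i, True) + g (j, i, False)) + (\<Sum>j<N. g (j, j, True) + g (j, j, False))"
proof -
  have "(\<Sum>m\<in>root_idx N. g m) = (\<Sum>j<N. \<Sum>p\<in>{..j} \<times> UNIV. g (j, p))"
    unfolding root_idx_def by (subst sum.Sigma) auto
  also have "\<dots> = (\<Sum>j<N. \<Sum>i\<le>j. \<Sum>s\<in>UNIV. g (j, i, s))"
    by (simp add: sum.cartesian_product)
  also have "\<dots> = (\<Sum>j<N. (\<Sum>i<j. g (j, i, True) + g (j, i, False)) + (g (j, j, True) + g (j, j, False)))"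
    by (simp add: UNIV_bool lessThan_Suc_atMost[symmetric] add.commute)
  finally show ?thesis by (simp add: sum.distrib)
qed

lemma prod_root_idx:
  fixes g :: "nat \<times> nat \<times> bool \<Rightarrow> real"
  shows "(\<Prod>m\<in>root_idx N. g m) =
    (\<Prod>j<N. \<Prod>i<j. g (j, i, True) * g (j, i, False)) * (\<Prod>j<N. g (j, j, True) * g (j, j, False))"
proof -
  have "(\<Prod>m\<in>root_idx N. g m) = (\<Prod>j<N. \<Prod>p\<in>{..j} \<times> UNIV. g (j, p))"
    unfolding root_idx_def by (subst prod.Sigma) auto
  also have "\<dots> = (\<Prod>j<N. \<Prod>i\<le>j. \<Prod>s\<in>UNIV. g (j, i, s))"
    by (simp add: prod.cartesian_product)
  also have "\<dots> = (\<Prod>j<N. (\<Prod>i<j. g (j, i, True) * g (j, i, False)) * (g (j, j, True) * g (j, j, False)))"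
    by (simp add: UNIV_bool lessThan_Suc_atMost[symmetric] mult.commute)
  finally show ?thesis by (simp add: prod.distrib)
qed

definition root_dens :: "nat \<Rightarrow> real \<Rightarrow> real \<Rightarrow> real \<Rightarrow> (nat \<Rightarrow> real) \<Rightarrow> real" where
  "root_dens N a b \<kappa> t = (\<Prod>m\<in>root_idx N. rpow (sin (root_form m t)) (\<kappa> * root_mult a b m))"

lemma root_form_chamber:
  assumes "t \<in> chamberA N" "m \<in> root_idx N"
  shows "0 \<le> root_form m t" "root_form m t \<le> pi"
proof -
  obtain j i s where m: "m = (j, i, s)" by (cases m)
  then have ij: "j < N" "i \<le> j" using assms(2) by (auto simp: root_idx_def)
  have "0 \<le> t i" "t i \<le> pi / 2" "0 \<le> t j" "t j \<le> pi / 2" "i \<noteq> j \<Longrightarrow> t j \<le> t i"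
    using assms(1) ij by (auto simp: chamberA_def)
  then show "0 \<le> root_form m t" "root_form m t \<le> pi" by (auto simp: m)
qed

lemma chamber_of_root_form:
  assumes "t \<in> RN N" "\<And>m. m \<in> root_idx N \<Longrightarrow> 0 < root_form m t \<and> root_form m t < pi"
  shows "t \<in> chamberA N"
proof -
  have "0 \<le> t i \<and> t i \<le> pi / 2" if "i < N" for i
    using assms(2)[of "(i, i, True)"] that by (auto simp: root_idx_def)
  moreover have "t j \<le> t i" if "i < j" "j < N" for i j
    using assms(2)[of "(j, i, False)"] that by (auto simp: root_idx_def)
  ultimately show ?thesis using assms(1) by (auto simp: chamberA_def)
qed

text \<open>Membership in the chamber makes both sines nonnegative, which is what allows the power
  to be distributed over the factors.\<close>

lemma trig_dens_root_dens:
  assumes t: "t \<in> chamberA N"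
  shows "trig_dens N a b \<kappa> t = (\<Prod>j<N. \<Prod>i<j. rpow 2 \<kappa>) * root_dens N a b \<kappa> t"
proof -
  have "rpow (cos (2 * t j) - cos (2 * t i)) \<kappa> =
      rpow 2 \<kappa> * (rpow (sin (t i + t j)) \<kappa> * rpow (sin (t i - t j)) \<kappa>)" if "j < N" "i < j" for i j
  proof -
    have "(j, i, s) \<in> root_idx N" for s using that by (auto simp: root_idx_def)
    from root_form_chamber[OF t this, of True] root_form_chamber[OF t this, of False]
    have "sin (t i + t j) \<ge> 0" "sin (t i - t j) \<ge> 0" using that by (auto intro: sin_ge_zero)
    moreover have "cos (2 * t j) - cos (2 * t i) = 2 * (sin (t i + t j) * sin (t i - t j))"
      using cos_diff_cos[of "2 * t j" "2 * t i"] by (simp add: add_divide_distrib diff_divide_distrib add.commute)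
    ultimately show ?thesis by (simp add: rpow_mult)
  qed
  then have "(\<Prod>j<N. \<Prod>i<j. rpow (cos (2 * t j) - cos (2 * t i)) \<kappa>) =
     (\<Prod>j<N. \<Prod>i<j. rpow 2 \<kappa> * (rpow (sin (t i + t j)) \<kappa> * rpow (sin (t i - t j)) \<kappa>))"
    by (intro prod.cong) auto
  also have "\<dots> = (\<Prod>j<N. \<Prod>i<j. rpow 2 \<kappa>) * (\<Prod>j<N. \<Prod>i<j. rpow (sin (t i + t j)) \<kappa> * rpow (sin (t i - t j)) \<kappa>)"
    by (simp add: prod.distrib)
  also have "(\<Prod>j<N. \<Prod>i<j. rpow (sin (t i + t j)) \<kappa> * rpow (sin (t i - t j)) \<kappa>) =
     (\<Prod>j<N. \<Prod>i<j. rpow (sin (root_form (j, i, True) t)) (\<kappa> * root_mult a b (j, i, True))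
         * rpow (sin (root_form (j, i, False) t)) (\<kappa> * root_mult a b (j, i, False)))"
    by (intro prod.cong) auto
  finally show ?thesis unfolding trig_dens_def root_dens_def prod_root_idx by (simp add: mult_ac)
qed

lemma root_form_linear:
  "root_form m (\<lambda>i. c * x i) = c * root_form m x"
  "root_form m (\<lambda>i. x i + y i) = root_form m x + root_form m y"
  "root_form m (\<lambda>i. x i - y i) = root_form m x - root_form m y"
  by (cases m; simp add: algebra_simps)+

lemma root_form_cong:
  assumes "m \<in> root_idx N" "\<And>i. i < N \<Longrightarrow> x i = y i"
  shows "root_form m x = root_form m y"
  using assms by (cases m) (auto simp: root_idx_def)

lemma root_mult_nonneg: "a \<ge> 0 \<Longrightarrow> b > 0 \<Longrightarrow> root_mult a b m \<ge> 0"
  by (cases m) auto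

text \<open>Pinning the coordinates from N on to \<open>undefined\<close> places the chamber in a
  product of compact sets, where the order relations are closed conditions.\<close>

lemma compact_chamberA: "compact (chamberA N)"
proof -
  define B where "B = PiE UNIV (\<lambda>i. if i < N then {0..pi/2} else {undefined :: real})"
  have "compactin (product_topology (\<lambda>i. euclidean) UNIV) B"
    unfolding B_def by (subst compactin_PiE) auto
  then have B: "compact B" by (simp add: euclidean_product_topology)
  have "closed {t :: nat \<Rightarrow> real. \<forall>i j. i < j \<and> j < N \<longrightarrow> t j \<le> t i}"
    by (intro closed_Collect_all closed_Collect_imp open_Collect_const closed_Collect_le continuous_on_coordinatewise_then_product continuous_on_product_coordinates)
  then have "compact (B \<inter> {t. \<forall>i j. i < j \<and> j < N \<longrightarrow> t j \<le> t i})"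
    using B by (rule compact_Int_closed[rotated])
  moreover have "B \<inter> {t. \<forall>i j. i < j \<and> j < N \<longrightarrow> t j \<le> t i} = chamberA N"
    by (auto simp: B_def chamberA_def PiE_iff extensional_def split: if_splits)
  ultimately show ?thesis by simp
qed

lemma continuous_on_root_dens:
  assumes "a \<ge> 0" "b > 0"
  shows "continuous_on (chamberA N) (root_dens N a b 1)"
  unfolding root_dens_def
proof (rule continuous_on_prod)
  fix m assume m: "m \<in> root_idx N"
  obtain j i s where ms: "m = (j, i, s)" by (cases m)
  have c: "continuous_on (chamberA N) (\<lambda>t. t k)" for k
    by (rule continuous_on_subset[OF continuous_on_product_coordinates]) simp
  have cf: "continuous_on (chamberA N) (\<lambda>t. sin (root_form m t))"
    unfolding ms by (cases "i = j"; cases s; simp; intro continuous_intros c)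
  show "continuous_on (chamberA N) (\<lambda>t. rpow (sin (root_form m t)) (1 * root_mult a b m))"
  proof (cases "root_mult a b m = 0")
    case False
    then have p: "root_mult a b m > 0" using root_mult_nonneg[OF assms, of m] by simp
    have sn: "sin (root_form m t) \<ge> 0" if "t \<in> chamberA N" for t
      using root_form_chamber[OF that m] by (intro sin_ge_zero)
    have "continuous_on (chamberA N) (\<lambda>t. sin (root_form m t) powr root_mult a b m)"
      by (intro continuous_on_powr' cf continuous_on_const) (use sn p in auto)
    then show ?thesis using False by (simp add: rpow_def)
  qed (simp add: rpow_def)
qed

section \<open>The maximiser of the density, its criticality and the bounds around it\<close>

lemma root_dens_interior:
  assumes "\<And>m. m \<in> root_idx N \<Longrightarrow> 0 < root_form m t \<and> root_form m t < pi"
  shows "root_dens N a b \<kappa> t = exp (\<Sum>m\<in>root_idx N. \<kappa> * root_mult a b m * ln (sin (root_form m t)))"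
  unfolding root_dens_def exp_sum[OF finite_root_idx]
  using assms by (intro prod.cong) (auto simp: rpow_pos sin_gt_zero)

text \<open>The density is positive somewhere, hence at its maximum, so no sine with positive
  multiplicity vanishes there. Taking \<kappa> = 1 suffices, because the later bounds for all
  \<kappa> use only the critical point equations.\<close>

lemma root_dens_maximizer:
  assumes a: "a \<ge> 0" and b: "b > 0"
  obtains w where "w \<in> chamberA N" "\<And>m. m \<in> root_idx N \<Longrightarrow> 0 < root_form m w \<and> root_form m w < pi"
    "\<And>t. t \<in> chamberA N \<Longrightarrow> root_dens N a b 1 t \<le> root_dens N a b 1 w"
proof -
  \<comment> \<open>Equally spaced decreasing angles strictly between 0 and pi / 2, a point at which
    no form degenerates.\<close>
  define t0 where "t0 = (\<lambda>i\<in>{..<N}. pi / 2 * ((real N - real i) / (real N + 1)))"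
  have t0: "0 < root_form m t0 \<and> root_form m t0 < pi" if m: "m \<in> root_idx N" for m
  proof -
    obtain j i s where ms: "m = (j, i, s)" by (cases m)
    then have ij: "j < N" "i \<le> j" using m by (auto simp: root_idx_def)
    have v: "0 < t0 k" "t0 k < pi / 2" if "k < N" for k
    proof -
      have "0 < (real N - real k) / (real N + 1)" "(real N - real k) / (real N + 1) < 1"
        using that by (auto simp: field_simps)
      then show "0 < t0 k" "t0 k < pi / 2" using that mult_strict_left_mono[of "(real N - real k) / (real N + 1)" 1 "pi / 2"]
        by (auto simp: t0_def)
    qed
    have "t0 j < t0 i" if "i \<noteq> j"
    proof -
      have "(real N - real j) / (real N + 1) < (real N - real i) / (real N + 1)"
        using that ij by (intro divide_strict_right_mono) auto
      then have "pi / 2 * ((real N - real j) / (real N + 1)) < pi / 2 * ((real N - real i) / (real N + 1))"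
        by (intro mult_strict_left_mono) auto
      moreover have "t0 k = pi / 2 * ((real N - real k) / (real N + 1))" if "k < N" for k
        using that by (simp add: t0_def)
      ultimately show ?thesis using ij by simp
    qed
    then show ?thesis using v[of i] v[of j] ij by (auto simp: ms)
  qed
  have t0c: "t0 \<in> chamberA N" by (rule chamber_of_root_form[OF _ t0]) (simp add: t0_def)
  then obtain w where w: "w \<in> chamberA N" "\<And>t. t \<in> chamberA N \<Longrightarrow> root_dens N a b 1 t \<le> root_dens N a b 1 w"
    using continuous_attains_sup[OF compact_chamberA _ continuous_on_root_dens[OF a b, of N]] by blast
  have "0 < root_dens N a b 1 t0" using root_dens_interior[of N t0 a b 1] t0 by simp
  also have "\<dots> \<le> root_dens N a b 1 w" using w(2)[OF t0c] .
  finally have pos: "root_dens N a b 1 w > 0" .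
  have key: "0 < root_form m w \<and> root_form m w < pi" if m: "m \<in> root_idx N" and p: "root_mult a b m > 0" for m
  proof -
    have "rpow (sin (root_form m w)) (1 * root_mult a b m) \<noteq> 0"
      using pos m unfolding root_dens_def by (metis finite_root_idx less_irrefl prod_zero_iff)
    then have "sin (root_form m w) \<noteq> 0" using p by (auto simp: rpow_def)
    then have "root_form m w \<noteq> 0" "root_form m w \<noteq> pi" by auto
    then show ?thesis using root_form_chamber[OF w(1) m] by auto
  qed
  have "0 < root_form m w \<and> root_form m w < pi" if m: "m \<in> root_idx N" for m
  proof (cases "root_mult a b m > 0")
    \<comment> \<open>Only t_j can have multiplicity 0, namely when a = 0; it is half of the form 2
      t_j, whose multiplicity b is positive.\<close>
    case False
    obtain j i s where ms: "m = (j, i, s)" by (cases m)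
    then have "i = j" "\<not> s" using False b by (auto split: if_splits)
    moreover have "(j, j, True) \<in> root_idx N" using m ms by (auto simp: root_idx_def)
    ultimately show ?thesis using key[of "(j, j, True)"] b by (auto simp: ms)
  qed (rule key[OF m])
  then show ?thesis using that w by blast
qed

lemma root_dens_critical:
  assumes w: "w \<in> chamberA N" "\<And>m. m \<in> root_idx N \<Longrightarrow> 0 < root_form m w \<and> root_form m w < pi"
    and max: "\<And>t. t \<in> chamberA N \<Longrightarrow> root_dens N a b 1 t \<le> root_dens N a b 1 w"
  shows "(\<Sum>m\<in>root_idx N. root_mult a b m * cot (root_form m w) * root_form m x) = 0"
proof -
  define h where "h u = (\<Sum>m\<in>root_idx N. root_mult a b m * ln (sin (root_form m w + u * root_form m x)))" for u
  have "(h has_real_derivative (\<Sum>m\<in>root_idx N. root_mult a b m * cot (root_form m w) * root_form m x)) (at 0)"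
    unfolding h_def
  proof (rule DERIV_sum)
    fix m assume m: "m \<in> root_idx N"
    have "((\<lambda>u. ln (sin (root_form m w + u * root_form m x))) has_real_derivative cot (root_form m w) * root_form m x) (at 0)"
      using w(2)[OF m] by (auto intro!: derivative_eq_intros simp: sin_gt_zero cot_def)
    from DERIV_cmult[OF this, of "root_mult a b m"]
    show "((\<lambda>u. root_mult a b m * ln (sin (root_form m w + u * root_form m x))) has_real_derivative
        root_mult a b m * cot (root_form m w) * root_form m x) (at 0)"
      by (simp add: mult.assoc)
  qed
  moreover have "\<forall>\<^sub>F u in nhds 0. \<forall>m\<in>root_idx N. 0 < root_form m w + u * root_form m x \<and> root_form m w + u * root_form m x < pi"
  proof (intro eventually_ball_finite finite_root_idx ballI)
    fix m assume m: "m \<in> root_idx N"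
    have "((\<lambda>u. root_form m w + u * root_form m x) \<longlongrightarrow> root_form m w) (nhds 0)"
      by (auto intro!: tendsto_eq_intros filterlim_ident)
    then show "\<forall>\<^sub>F u in nhds 0. 0 < root_form m w + u * root_form m x \<and> root_form m w + u * root_form m x < pi"
      using w(2)[OF m] by (intro eventually_conj order_tendstoD) auto
  qed
  then obtain d where d: "d > 0" "\<And>u m. \<bar>u\<bar> < d \<Longrightarrow> m \<in> root_idx N \<Longrightarrow>
      0 < root_form m w + u * root_form m x \<and> root_form m w + u * root_form m x < pi"
    unfolding eventually_nhds_metric by (auto simp: dist_real_def)
  have "\<forall>u. \<bar>0 - u\<bar> < d \<longrightarrow> h u \<le> h 0"
  proof (intro allI impI)
    fix u assume "\<bar>0 - u\<bar> < d"
    then have u: "\<bar>u\<bar> < d" by simp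
    define t where "t = (\<lambda>i\<in>{..<N}. w i + u * x i)"
    have tf: "root_form m t = root_form m w + u * root_form m x" if "m \<in> root_idx N" for m
      using root_form_cong[OF that, of t "\<lambda>i. w i + u * x i"]
      by (simp add: t_def root_form_linear)
    have ti: "0 < root_form m t \<and> root_form m t < pi" if "m \<in> root_idx N" for m
      using d(2)[OF u that] by (simp add: tf[OF that])
    have "t \<in> chamberA N" by (rule chamber_of_root_form[OF _ ti]) (simp add: t_def)
    from max[OF this] have "exp (\<Sum>m\<in>root_idx N. 1 * root_mult a b m * ln (sin (root_form m t))) \<le>
       exp (\<Sum>m\<in>root_idx N. 1 * root_mult a b m * ln (sin (root_form m w)))"
      by (simp only: root_dens_interior[OF ti] root_dens_interior[OF w(2)])
    then have "(\<Sum>m\<in>root_idx N. 1 * root_mult a b m * ln (sin (root_form m t))) \<le>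
       (\<Sum>m\<in>root_idx N. 1 * root_mult a b m * ln (sin (root_form m w)))"
      by (simp only: exp_le_cancel_iff)
    moreover have "h u = (\<Sum>m\<in>root_idx N. 1 * root_mult a b m * ln (sin (root_form m t)))"
      unfolding h_def by (intro sum.cong) (simp_all add: tf)
    moreover have "h 0 = (\<Sum>m\<in>root_idx N. 1 * root_mult a b m * ln (sin (root_form m w)))"
      by (simp add: h_def)
    ultimately show "h u \<le> h 0" by simp
  qed
  ultimately show ?thesis using d(1) by (intro DERIV_local_max) auto
qed

text \<open>The forms 2 x_j with multiplicity b already contribute 4 b x_j^2, and all other terms
  are nonnegative.\<close>

lemma root_form_coercive:
  assumes a: "a \<ge> 0"
  shows "4 * b * (\<Sum>i<N. (x i)\<^sup>2) \<le> (\<Sum>m\<in>root_idx N. root_mult a b m * (root_form m x)\<^sup>2)"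
proof -
  let ?g = "\<lambda>m. root_mult a b m * (root_form m x)\<^sup>2"
  have "0 \<le> (\<Sum>j<N. \<Sum>i<j. ?g (j, i, True) + ?g (j, i, False))"
    by (intro sum_nonneg) auto
  moreover have "(\<Sum>j<N. b * (2 * x j)\<^sup>2) \<le> (\<Sum>j<N. ?g (j, j, True) + ?g (j, j, False))"
    using a by (intro sum_mono) auto
  moreover have "(\<Sum>j<N. b * (2 * x j)\<^sup>2) = 4 * b * (\<Sum>i<N. (x i)\<^sup>2)"
    by (simp add: sum_distrib_left power_mult_distrib mult_ac)
  ultimately show ?thesis unfolding sum_root_idx by linarith
qed

text \<open>Multiplying the tangent bounds over all roots, the linear terms add up to zero by
  criticality. The constant 2 b is half of the 4 b from \<open>root_form_coercive\<close>.\<close>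

lemma root_dens_bound:
  assumes a: "a \<ge> 0" and b: "b > 0"
    and w: "\<And>m. m \<in> root_idx N \<Longrightarrow> 0 < root_form m w \<and> root_form m w < pi"
    and crit: "\<And>x. (\<Sum>m\<in>root_idx N. root_mult a b m * cot (root_form m w) * root_form m x) = 0"
    and t: "t \<in> chamberA N" and k: "\<kappa> > 0"
  shows "root_dens N a b \<kappa> t \<le> root_dens N a b \<kappa> w * exp (- \<kappa> * (2 * b) * (\<Sum>i<N. (t i - w i)\<^sup>2))"
proof -
  define x where "x i = t i - w i" for i
  have lx: "root_form m x = root_form m t - root_form m w" for m
    unfolding x_def by (rule root_form_linear)
  let ?c = "root_mult a b"
  have "root_dens N a b \<kappa> t \<le> (\<Prod>m\<in>root_idx N. rpow (sin (root_form m w)) (\<kappa> * ?c m)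
      * exp (\<kappa> * ?c m * (cot (root_form m w) * root_form m x - (root_form m x)\<^sup>2 / 2)))"
    unfolding root_dens_def
  proof (rule prod_mono, intro conjI)
    fix m assume m: "m \<in> root_idx N"
    show "0 \<le> rpow (sin (root_form m t)) (\<kappa> * ?c m)" by (rule rpow_nonneg)
    show "rpow (sin (root_form m t)) (\<kappa> * ?c m) \<le> rpow (sin (root_form m w)) (\<kappa> * ?c m)
      * exp (\<kappa> * ?c m * (cot (root_form m w) * root_form m x - (root_form m x)\<^sup>2 / 2))"
      unfolding lx using w[OF m] root_form_chamber[OF t m] root_mult_nonneg[OF a b, of m] k
      by (intro rpow_sin_bound) auto
  qed
  also have "\<dots> = root_dens N a b \<kappa> w * exp (\<Sum>m\<in>root_idx N. \<kappa> * ?c m * (cot (root_form m w) * root_form m x - (root_form m x)\<^sup>2 / 2))"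
    by (simp add: root_dens_def prod.distrib exp_sum)
  also have "(\<Sum>m\<in>root_idx N. \<kappa> * ?c m * (cot (root_form m w) * root_form m x - (root_form m x)\<^sup>2 / 2)) =
     \<kappa> * (\<Sum>m\<in>root_idx N. ?c m * cot (root_form m w) * root_form m x) - \<kappa> / 2 * (\<Sum>m\<in>root_idx N. ?c m * (root_form m x)\<^sup>2)"
    unfolding sum_distrib_left sum_subtractf[symmetric] by (intro sum.cong refl) (simp add: algebra_simps)
  also have "\<dots> = - (\<kappa> / 2 * (\<Sum>m\<in>root_idx N. ?c m * (root_form m x)\<^sup>2))" by (simp add: crit)
  also have "root_dens N a b \<kappa> w * exp (- (\<kappa> / 2 * (\<Sum>m\<in>root_idx N. ?c m * (root_form m x)\<^sup>2))) \<le>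
     root_dens N a b \<kappa> w * exp (- \<kappa> * (2 * b) * (\<Sum>i<N. (x i)\<^sup>2))"
  proof (rule mult_left_mono)
    have "\<kappa> / 2 * (4 * b * (\<Sum>i<N. (x i)\<^sup>2)) \<le> \<kappa> / 2 * (\<Sum>m\<in>root_idx N. ?c m * (root_form m x)\<^sup>2)"
      using k root_form_coercive[OF a] by (intro mult_left_mono) auto
    then show "exp (- (\<kappa> / 2 * (\<Sum>m\<in>root_idx N. ?c m * (root_form m x)\<^sup>2))) \<le> exp (- \<kappa> * (2 * b) * (\<Sum>i<N. (x i)\<^sup>2))"
      by (simp add: algebra_simps)
    show "0 \<le> root_dens N a b \<kappa> w" unfolding root_dens_def by (intro prod_nonneg rpow_nonneg)
  qed
  finally show ?thesis by (simp add: x_def)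
qed

text \<open>Each factor has a linear term of order sqrt \<kappa> in its exponent, which cancels only
  in the sum over all roots; \<open>R\<close> is the exponent without it. Since w is interior, the
  indicator is eventually 1.\<close>

lemma root_dens_limit:
  assumes w: "\<And>m. m \<in> root_idx N \<Longrightarrow> 0 < root_form m w \<and> root_form m w < pi"
    and crit: "\<And>x. (\<Sum>m\<in>root_idx N. root_mult a b m * cot (root_form m w) * root_form m x) = 0"
  shows "((\<lambda>\<kappa>. indicator (chamberA N) (\<lambda>i\<in>{..<N}. w i + x i / sqrt \<kappa>)
        * root_dens N a b \<kappa> (\<lambda>i\<in>{..<N}. w i + x i / sqrt \<kappa>) / root_dens N a b \<kappa> w)
     \<longlongrightarrow> exp (- (\<Sum>m\<in>root_idx N. root_mult a b m * (root_form m x)\<^sup>2 / (sin (root_form m w))\<^sup>2) / 2)) at_top"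
proof -
  let ?c = "root_mult a b"
  define R where "R \<kappa> m = \<kappa> * (ln (sin (root_form m w + root_form m x / sqrt \<kappa>)) - ln (sin (root_form m w))
      - cot (root_form m w) * (root_form m x / sqrt \<kappa>))" for \<kappa> m
  have "((\<lambda>\<kappa>. exp (\<Sum>m\<in>root_idx N. ?c m * R \<kappa> m)) \<longlongrightarrow>
     exp (\<Sum>m\<in>root_idx N. ?c m * (- (root_form m x)\<^sup>2 / (2 * (sin (root_form m w))\<^sup>2)))) at_top"
    unfolding R_def using w by (intro tendsto_exp tendsto_sum tendsto_mult_left ln_sin_second_order) auto
  also have "(\<Sum>m\<in>root_idx N. ?c m * (- (root_form m x)\<^sup>2 / (2 * (sin (root_form m w))\<^sup>2))) =
    - (\<Sum>m\<in>root_idx N. ?c m * (root_form m x)\<^sup>2 / (sin (root_form m w))\<^sup>2) / 2"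
    unfolding sum_negf[symmetric] sum_divide_distrib by (intro sum.cong refl) simp
  finally have lim: "((\<lambda>\<kappa>. exp (\<Sum>m\<in>root_idx N. ?c m * R \<kappa> m)) \<longlongrightarrow>
    exp (- (\<Sum>m\<in>root_idx N. ?c m * (root_form m x)\<^sup>2 / (sin (root_form m w))\<^sup>2) / 2)) at_top" .
  have ev: "\<forall>\<^sub>F \<kappa> in at_top. \<forall>m\<in>root_idx N. 0 < root_form m w + root_form m x / sqrt \<kappa> \<and> root_form m w + root_form m x / sqrt \<kappa> < pi"
  proof (intro eventually_ball_finite finite_root_idx ballI)
    fix m assume m: "m \<in> root_idx N"
    have "((\<lambda>\<kappa>. root_form m x / sqrt \<kappa>) \<longlongrightarrow> 0) at_top"
      by (intro tendsto_divide_0[OF tendsto_const] filterlim_at_top_imp_at_infinity sqrt_at_top)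
    then have "((\<lambda>\<kappa>. root_form m w + root_form m x / sqrt \<kappa>) \<longlongrightarrow> root_form m w) at_top"
      using tendsto_add[OF tendsto_const] by fastforce
    then show "\<forall>\<^sub>F \<kappa> in at_top. 0 < root_form m w + root_form m x / sqrt \<kappa> \<and> root_form m w + root_form m x / sqrt \<kappa> < pi"
      using w[OF m] by (intro eventually_conj order_tendstoD) auto
  qed
  have "\<forall>\<^sub>F \<kappa> in at_top. exp (\<Sum>m\<in>root_idx N. ?c m * R \<kappa> m) =
     indicator (chamberA N) (\<lambda>i\<in>{..<N}. w i + x i / sqrt \<kappa>)
        * root_dens N a b \<kappa> (\<lambda>i\<in>{..<N}. w i + x i / sqrt \<kappa>) / root_dens N a b \<kappa> w"
    using ev
  proof eventually_elim
    case (elim \<kappa>)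
    define t where "t = (\<lambda>i\<in>{..<N}. w i + x i / sqrt \<kappa>)"
    have tf: "root_form m t = root_form m w + root_form m x / sqrt \<kappa>" if "m \<in> root_idx N" for m
    proof -
      have "root_form m t = root_form m (\<lambda>i. w i + (1 / sqrt \<kappa>) * x i)"
        using that by (rule root_form_cong) (simp add: t_def)
      then show ?thesis unfolding root_form_linear by simp
    qed
    have ti: "0 < root_form m t \<and> root_form m t < pi" if "m \<in> root_idx N" for m
      using elim that by (simp add: tf)
    have tc: "t \<in> chamberA N" by (rule chamber_of_root_form[OF _ ti]) (simp add: t_def)
    have "root_dens N a b \<kappa> t / root_dens N a b \<kappa> w =
      exp ((\<Sum>m\<in>root_idx N. \<kappa> * ?c m * ln (sin (root_form m t))) - (\<Sum>m\<in>root_idx N. \<kappa> * ?c m * ln (sin (root_form m w))))"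
      by (simp only: root_dens_interior[OF ti] root_dens_interior[OF w] exp_diff)
    also have "(\<Sum>m\<in>root_idx N. \<kappa> * ?c m * ln (sin (root_form m t))) - (\<Sum>m\<in>root_idx N. \<kappa> * ?c m * ln (sin (root_form m w)))
      = (\<Sum>m\<in>root_idx N. ?c m * R \<kappa> m + \<kappa> / sqrt \<kappa> * (?c m * cot (root_form m w) * root_form m x))"
      unfolding sum_subtractf[symmetric] by (intro sum.cong refl) (simp add: R_def tf algebra_simps)
    also have "\<dots> = (\<Sum>m\<in>root_idx N. ?c m * R \<kappa> m)"
      by (simp only: sum.distrib sum_distrib_left[symmetric] crit mult_zero_right add_0_right)
    finally show ?case unfolding t_def[symmetric] using tc by simp
  qed
  with lim show ?thesis by (rule Lim_transform_eventually)
qed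

section \<open>First and second order conditions in the variables cos (2 w_i)\<close>

lemma sum_off_diagonal:
  fixes F :: "nat \<Rightarrow> nat \<Rightarrow> real"
  shows "(\<Sum>i<N. \<Sum>k\<in>{..<N} - {i}. F i k) = (\<Sum>j<N. \<Sum>k<j. F k j + F j k)"
proof (induction N)
  case (Suc N)
  have "(\<Sum>i<Suc N. \<Sum>k\<in>{..<Suc N} - {i}. F i k) = (\<Sum>i<N. \<Sum>k\<in>{..<Suc N} - {i}. F i k) + (\<Sum>k\<in>{..<Suc N} - {N}. F N k)"
    by simp
  also have "(\<Sum>i<N. \<Sum>k\<in>{..<Suc N} - {i}. F i k) = (\<Sum>i<N. F i N + (\<Sum>k\<in>{..<N} - {i}. F i k))"
  proof (rule sum.cong[OF refl])
    fix i assume "i \<in> {..<N}"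
    then have "{..<Suc N} - {i} = insert N ({..<N} - {i})" by auto
    then show "(\<Sum>k\<in>{..<Suc N} - {i}. F i k) = F i N + (\<Sum>k\<in>{..<N} - {i}. F i k)" by simp
  qed
  also have "{..<Suc N} - {N} = {..<N}" by auto
  finally show ?case using Suc.IH by (simp add: sum.distrib)
qed simp


lemma sin_root_nonzero:
  assumes w: "\<And>m. m \<in> root_idx N \<Longrightarrow> 0 < root_form m w \<and> root_form m w < pi"
    and ik: "i < N" "k < N" "i \<noteq> k"
  shows "sin (w i + w k) \<noteq> 0" "sin (w i - w k) \<noteq> 0"
proof -
  have sin_odd: "sin (w k - w i) = - sin (w i - w k)"
    using sin_minus[of "w i - w k"] by simp
  let ?m = "\<lambda>s. (max i k, min i k, s)"
  have m: "?m s \<in> root_idx N" for s using ik by (auto simp: root_idx_def max_def)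
  have "sin (root_form (?m s) w) > 0" for s using w[OF m] sin_gt_zero by blast
  from this[of True] this[of False] ik
  have "sin (w i + w k) > 0 \<and> (sin (w i - w k) > 0 \<or> sin (w k - w i) > 0)"
    by (cases "i < k") (auto simp: max_def min_def add.commute split: if_splits)
  then show "sin (w i + w k) \<noteq> 0" "sin (w i - w k) \<noteq> 0" using sin_odd by auto
qed

text \<open>The critical point equations become Stieltjes' equations for \<open>cos (2 * w i)\<close>, since
  \<open>cot (x + y) + cot (x - y) = 2 * sin (2 * x) / (cos (2 * y) - cos (2 * x))\<close>.\<close>

lemma critical_stieltjes:
  assumes w: "\<And>m. m \<in> root_idx N \<Longrightarrow> 0 < root_form m w \<and> root_form m w < pi"
    and crit: "\<And>x. (\<Sum>m\<in>root_idx N. root_mult a b m * cot (root_form m w) * root_form m x) = 0"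
    and i: "i < N" and z: "\<And>i. i < N \<Longrightarrow> z i = cos (2 * w i)"
  shows "2 * (1 - (z i)\<^sup>2) * (\<Sum>l\<in>{..<N} - {i}. 1 / (z i - z l)) = a + (a + 2 * b) * z i"
proof -
  \<comment> \<open>The i-th unit vector picks the i-th partial derivative out of the criticality
    relation.\<close>
  define x where "x k = (if k = i then 1 else 0 :: real)" for k
  define A where "A k l = cot (w k + w l) + cot (w k - w l)" for k l
  have odd: "cot (- y) = - cot y" for y :: real by (simp add: cot_def)
  have "0 = (\<Sum>j<N. \<Sum>k<j. cot (w k + w j) * (x k + x j) + cot (w k - w j) * (x k - x j))
     + (\<Sum>j<N. b * cot (2 * w j) * (2 * x j) + a * cot (w j) * x j)"
    using crit[of x] unfolding sum_root_idx by simp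
  also have "(\<Sum>j<N. \<Sum>k<j. cot (w k + w j) * (x k + x j) + cot (w k - w j) * (x k - x j))
     = (\<Sum>j<N. \<Sum>k<j. A k j * x k + A j k * x j)"
  proof (intro sum.cong refl)
    fix j k
    have "cot (w j - w k) = - cot (w k - w j)" using odd[of "w k - w j"] by simp
    then show "cot (w k + w j) * (x k + x j) + cot (w k - w j) * (x k - x j) = A k j * x k + A j k * x j"
      by (simp add: A_def algebra_simps)
  qed
  also have "\<dots> = (\<Sum>j<N. \<Sum>k\<in>{..<N} - {j}. A j k * x j)"
    by (rule sum_off_diagonal[symmetric])
  also have "\<dots> = (\<Sum>j<N. if j = i then (\<Sum>k\<in>{..<N} - {i}. A i k) else 0)"
    by (intro sum.cong refl) (simp add: x_def)
  also have "\<dots> = (\<Sum>k\<in>{..<N} - {i}. A i k)" using i by simp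
  also have "(\<Sum>j<N. b * cot (2 * w j) * (2 * x j) + a * cot (w j) * x j)
     = (\<Sum>j<N. if j = i then b * cot (2 * w i) * 2 + a * cot (w i) else 0)"
    by (intro sum.cong refl) (simp add: x_def)
  also have "\<dots> = b * cot (2 * w i) * 2 + a * cot (w i)" using i by simp
  finally have eq: "(\<Sum>k\<in>{..<N} - {i}. A i k) + (b * cot (2 * w i) * 2 + a * cot (w i)) = 0" by simp
  have wi: "0 < w i" "w i < pi" "0 < 2 * w i" "2 * w i < pi"
    using w[of "(i, i, True)"] w[of "(i, i, False)"] i by (auto simp: root_idx_def)
  have s2: "sin (2 * w i) > 0" "sin (w i) > 0" using sin_gt_zero wi by blast+
  have zi: "1 - (z i)\<^sup>2 = sin (2 * w i) * sin (2 * w i)"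
    using sin_cos_squared_add[of "2 * w i"] by (simp add: z[OF i] power2_eq_square)
  \<comment> \<open>The factor sin (2 w_i) turns the numerator of the cotangent sum into sin (2
    w_i)^2 = 1 - z_i^2.\<close>
  have "sin (2 * w i) * A i k = - 2 * (1 - (z i)\<^sup>2) * (1 / (z i - z k))" if k: "k \<in> {..<N} - {i}" for k
  proof -
    have pq: "sin (w i + w k) \<noteq> 0" "sin (w i - w k) \<noteq> 0"
      using sin_root_nonzero[OF w, of N i k] i k by auto
    have "z k - z i = 2 * (sin (w i + w k) * sin (w i - w k))"
      using cos_diff_cos[of "2 * w k" "2 * w i"] z[OF i] z[of k] k
      by (simp add: add_divide_distrib diff_divide_distrib add.commute)
    then have zk: "z i - z k = - 2 * (sin (w i + w k) * sin (w i - w k))" by simp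
    have "A i k = sin (2 * w i) / (sin (w i + w k) * sin (w i - w k))"
      using pq sin_add[of "w i + w k" "w i - w k"]
      by (simp add: A_def cot_def add_frac_eq mult_ac add.commute)
    then show ?thesis unfolding zk zi by simp
  qed
  then have "sin (2 * w i) * (\<Sum>k\<in>{..<N} - {i}. A i k) = - 2 * (1 - (z i)\<^sup>2) * (\<Sum>l\<in>{..<N} - {i}. 1 / (z i - z l))"
    unfolding sum_distrib_left by (intro sum.cong) auto
  moreover have "sin (2 * w i) * (b * cot (2 * w i) * 2 + a * cot (w i)) = 2 * b * z i + a * (1 + z i)"
  proof -
    have "sin (2 * w i) * cot (2 * w i) = z i" using s2 by (simp add: cot_def z[OF i])
    moreover have "sin (2 * w i) * cot (w i) = 1 + z i"
      using s2(2) cos_double_cos[of "w i"] by (simp add: cot_def sin_double z[OF i] power2_eq_square)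
    ultimately show ?thesis by (simp add: algebra_simps)
  qed
  moreover have "sin (2 * w i) * (\<Sum>k\<in>{..<N} - {i}. A i k) + sin (2 * w i) * (b * cot (2 * w i) * 2 + a * cot (w i)) = 0"
    using eq by (metis distrib_left mult_zero_right)
  ultimately show ?thesis by (simp add: algebra_simps)
qed

lemma sin_sum_diff_identities:
  fixes u v :: real
  shows "(sin (u + v))\<^sup>2 - (sin (u - v))\<^sup>2 = sin (2 * u) * sin (2 * v)"
    and "(sin (u + v))\<^sup>2 + (sin (u - v))\<^sup>2 = 1 - cos (2 * u) * cos (2 * v)"
    and "2 * (sin (u + v) * sin (u - v)) = cos (2 * v) - cos (2 * u)"
proof -
  define p q r s where "p = sin u" and "q = cos u" and "r = sin v" and "s = cos v"
  have one: "p\<^sup>2 + q\<^sup>2 = 1" "r\<^sup>2 + s\<^sup>2 = 1" by (simp_all add: p_def q_def r_def s_def)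
  have e: "sin (u + v) = p * s + q * r" "sin (u - v) = p * s - q * r" "sin (2 * u) = 2 * p * q" "sin (2 * v) = 2 * r * s"
    "cos (2 * u) = q\<^sup>2 - p\<^sup>2" "cos (2 * v) = s\<^sup>2 - r\<^sup>2"
    by (simp_all add: p_def q_def r_def s_def sin_add sin_diff sin_double cos_double)
  show "(sin (u + v))\<^sup>2 - (sin (u - v))\<^sup>2 = sin (2 * u) * sin (2 * v)"
    unfolding e by (simp add: power2_eq_square algebra_simps)
  have "(sin (u + v))\<^sup>2 + (sin (u - v))\<^sup>2 = (p\<^sup>2 + q\<^sup>2) * (r\<^sup>2 + s\<^sup>2) - cos (2 * u) * cos (2 * v)"
    unfolding e by (simp add: power2_eq_square algebra_simps)
  then show "(sin (u + v))\<^sup>2 + (sin (u - v))\<^sup>2 = 1 - cos (2 * u) * cos (2 * v)" by (simp add: one)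
  have "2 * (sin (u + v) * sin (u - v)) = cos (2 * v) * (p\<^sup>2 + q\<^sup>2) - cos (2 * u) * (r\<^sup>2 + s\<^sup>2)"
    unfolding e by (simp add: power2_eq_square algebra_simps)
  then show "2 * (sin (u + v) * sin (u - v)) = cos (2 * v) - cos (2 * u)" by (simp add: one)
qed

text \<open>The right side is the second derivative of the potential at w. Its mixed entries B - A
  are rational in z by \<open>sin_sum_diff_identities\<close>. For the diagonal, 1 - z_i z_k = (1 -
  z_i^2) + z_i (z_i - z_k) splits A + B into the stated sum and a multiple of the Stieltjes sum,
  which then merges with the one-particle term T.\<close>

lemma hess_quad_form:
  assumes w: "\<And>m. m \<in> root_idx N \<Longrightarrow> 0 < root_form m w \<and> root_form m w < pi"
    and crit: "\<And>x. (\<Sum>m\<in>root_idx N. root_mult a b m * cot (root_form m w) * root_form m x) = 0"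
    and z: "\<And>i. i < N \<Longrightarrow> z i = cos (2 * w i)"
  shows "quad_form N (hess N z a b) x =
    (\<Sum>m\<in>root_idx N. root_mult a b m * (root_form m x)\<^sup>2 / (sin (root_form m w))\<^sup>2)"
proof -
  define A where "A k l = 1 / (sin (w k - w l))\<^sup>2" for k l
  define B where "B k l = 1 / (sin (w k + w l))\<^sup>2" for k l
  define T where "T j = 4 * b / (sin (2 * w j))\<^sup>2 + a / (sin (w j))\<^sup>2" for j
  have symB: "B k l = B l k" for k l by (simp add: B_def add.commute)
  have sin_odd: "sin (w l - w k) = - sin (w k - w l)" for k l
    using sin_minus[of "w k - w l"] by simp
  have symA: "A k l = A l k" for k l
    unfolding A_def by (simp add: sin_odd[of l k])
  have pos: "sin (2 * w i) > 0" "sin (w i) > 0" if "i < N" for i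
    using w[of "(i, i, True)"] w[of "(i, i, False)"] that sin_gt_zero[of "2 * w i"] sin_gt_zero[of "w i"]
    by (auto simp: root_idx_def)
  have zs: "1 - (z i)\<^sup>2 = (sin (2 * w i))\<^sup>2" if "i < N" for i
    using sin_squared_eq[of "2 * w i"] by (simp add: z[OF that])
  have AB: "B i k - A i k = hess N z a b i k" "A i k + B i k = 4 * (1 - z i * z k) / (z i - z k)\<^sup>2" "z i \<noteq> z k"
    if ik: "i < N" "k < N" "i \<noteq> k" for i k
  proof -
    define p q where "p = sin (w i + w k)" and "q = sin (w i - w k)"
    have pq: "p \<noteq> 0" "q \<noteq> 0" using sin_root_nonzero[OF w ik] by (auto simp: p_def q_def)
    have zz: "z i - z k = - 2 * (p * q)"
      using sin_sum_diff_identities(3)[of "w i" "w k"] z[OF ik(1)] z[OF ik(2)] by (simp add: p_def q_def)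
    then show "z i \<noteq> z k" using pq by auto
    have sq: "(z i - z k)\<^sup>2 = 4 * (p\<^sup>2 * q\<^sup>2)" unfolding zz by (simp add: power_mult_distrib)
    have "sqrt ((1 - (z k)\<^sup>2) * (1 - (z i)\<^sup>2)) = sin (2 * w i) * sin (2 * w k)"
      using pos(1)[OF ik(1)] pos(1)[OF ik(2)] by (simp add: zs ik real_sqrt_mult)
    also have "\<dots> = p\<^sup>2 - q\<^sup>2" by (simp add: p_def q_def sin_sum_diff_identities)
    finally have "hess N z a b i k = - 4 * (p\<^sup>2 - q\<^sup>2) / (4 * (p\<^sup>2 * q\<^sup>2))"
      using ik(3) by (simp add: hess_def sq)
    moreover have fr: "1 / u - 1 / v = - 4 * (u - v) / (4 * (u * v))" "1 / v + 1 / u = 4 * (u + v) / (4 * (u * v))"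
      if "u \<noteq> 0" "v \<noteq> 0" for u v :: real
      using that by (simp_all add: field_simps)
    have pq2: "p\<^sup>2 \<noteq> 0" "q\<^sup>2 \<noteq> 0" using pq by simp_all
    ultimately show "B i k - A i k = hess N z a b i k"
      unfolding A_def B_def p_def[symmetric] q_def[symmetric] by (simp only: fr(1)[OF pq2])
    have "1 - z i * z k = p\<^sup>2 + q\<^sup>2"
      using sin_sum_diff_identities(2)[of "w i" "w k"] z[OF ik(1)] z[OF ik(2)] by (simp add: p_def q_def)
    then show "A i k + B i k = 4 * (1 - z i * z k) / (z i - z k)\<^sup>2"
      unfolding A_def B_def p_def[symmetric] q_def[symmetric] sq by (simp only: fr(2)[OF pq2])
  qed
  have diag: "hess N z a b i i = (\<Sum>k\<in>{..<N} - {i}. A i k + B i k) + T i" if i: "i < N" for i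
  proof -
    let ?J = "{..<N} - {i}"
    define y where "y = z i"
    define s1 where "s1 = (\<Sum>l\<in>?J. 1 / (y - z l))"
    have st: "2 * (1 - y\<^sup>2) * s1 = a + (a + 2 * b) * y"
      unfolding y_def s1_def by (rule critical_stieltjes[OF w crit i z])
    have y2: "1 - y\<^sup>2 > 0" unfolding y_def zs[OF i] using pos(1)[OF i] by simp
    then have "y \<noteq> 1" "y \<noteq> - 1" by auto
    then have y1: "1 - y \<noteq> 0" "1 + y \<noteq> 0" by linarith+
    have "(\<Sum>k\<in>?J. A i k + B i k) = (\<Sum>k\<in>?J. 4 * ((1 - y\<^sup>2) / (y - z k)\<^sup>2) + 4 * y * (1 / (y - z k)))"
    proof (rule sum.cong[OF refl])
      fix k assume k: "k \<in> ?J"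
      have d: "y - z k \<noteq> 0" using AB(3)[OF i, of k] k by (auto simp: y_def)
      have "4 * y * (1 / (y - z k)) = 4 * (y * (y - z k)) / (y - z k)\<^sup>2"
        using d by (simp add: power2_eq_square)
      then have "4 * ((1 - y\<^sup>2) / (y - z k)\<^sup>2) + 4 * y * (1 / (y - z k)) = (4 * (1 - y\<^sup>2) + 4 * (y * (y - z k))) / (y - z k)\<^sup>2"
        by (simp add: add_divide_distrib)
      also have "4 * (1 - y\<^sup>2) + 4 * (y * (y - z k)) = 4 * (1 - y * z k)" by (simp add: algebra_simps power2_eq_square)
      finally show "A i k + B i k = 4 * ((1 - y\<^sup>2) / (y - z k)\<^sup>2) + 4 * y * (1 / (y - z k))"
        using AB(2)[OF i, of k] k by (simp add: y_def)
    qed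
    also have "\<dots> = 4 * (\<Sum>k\<in>?J. (1 - y\<^sup>2) / (y - z k)\<^sup>2) + 4 * y * s1"
      by (simp only: sum.distrib sum_distrib_left s1_def)
    finally have 1: "(\<Sum>k\<in>?J. A i k + B i k) = 4 * (\<Sum>k\<in>?J. (1 - y\<^sup>2) / (y - z k)\<^sup>2) + 4 * y * s1" .
    have "(sin (w i))\<^sup>2 = (1 - y) / 2" using cos_double_sin[of "w i"] z[OF i] by (simp add: y_def)
    moreover have "(sin (2 * w i))\<^sup>2 = 1 - y\<^sup>2" using zs[OF i] by (simp add: y_def)
    ultimately have "T i = 4 * b / (1 - y\<^sup>2) + a / ((1 - y) / 2)" by (simp only: T_def)
    then have Ti: "T i = 4 * b / (1 - y\<^sup>2) + 2 * a / (1 - y)" by simp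
    have fac: "1 - y\<^sup>2 = (1 - y) * (1 + y)" by (simp add: algebra_simps power2_eq_square)
    have s1: "s1 = (a + (a + 2 * b) * y) / (2 * (1 - y\<^sup>2))"
      using st y2 by (simp add: eq_divide_eq mult_ac)
    \<comment> \<open>After Stieltjes' equation is inserted for s1, both sides are fractions over (1
      - y) (1 + y) with equal numerators.\<close>
    have 2: "2 * (a + b) * (1 + y) / (1 - y) + 2 * b * (1 - y) / (1 + y) = 4 * y * s1 + T i"
    proof -
      have "4 * y * ((a + (a + 2 * b) * y) / (2 * (U * V))) + (4 * b / (U * V) + 2 * a / U) = 2 * (a + b) * V / U + 2 * b * U / V"
        if "U \<noteq> 0" "V \<noteq> 0" "U = 1 - y" "V = 1 + y" for U V
      proof -
        have "2 * (a + b) * V / U = 2 * (a + b) * V\<^sup>2 / (U * V)" "2 * b * U / V = 2 * b * U\<^sup>2 / (U * V)"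
          using that(1,2) by (simp_all add: power2_eq_square)
        then have "2 * (a + b) * V / U + 2 * b * U / V = (2 * (a + b) * V\<^sup>2 + 2 * b * U\<^sup>2) / (U * V)"
          by (simp only: add_divide_distrib)
        moreover have "4 * y * ((a + (a + 2 * b) * y) / (2 * (U * V))) = 2 * y * (a + (a + 2 * b) * y) / (U * V)"
          by simp
        moreover have "2 * a / U = 2 * a * V / (U * V)"
          using that(1,2) by simp
        ultimately have e: "2 * (a + b) * V / U + 2 * b * U / V = (2 * (a + b) * V\<^sup>2 + 2 * b * U\<^sup>2) / (U * V)"
          "4 * y * ((a + (a + 2 * b) * y) / (2 * (U * V))) + (4 * b / (U * V) + 2 * a / U)
           = (2 * y * (a + (a + 2 * b) * y) + 4 * b + 2 * a * V) / (U * V)"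
          by (simp_all only: add_divide_distrib add.assoc)
        have "2 * (a + b) * V\<^sup>2 + 2 * b * U\<^sup>2 = 2 * y * (a + (a + 2 * b) * y) + 4 * b + 2 * a * V"
          unfolding that(3,4) by (simp add: algebra_simps power2_eq_square)
        then show ?thesis unfolding e by (simp only:)
      qed
      from this[OF y1 refl refl] show ?thesis unfolding Ti s1 fac by (rule sym)
    qed
    have "hess N z a b i i = 4 * (\<Sum>k\<in>?J. (1 - y\<^sup>2) / (y - z k)\<^sup>2)
        + 2 * (a + b) * (1 + y) / (1 - y) + 2 * b * (1 - y) / (1 + y)"
      by (simp add: hess_def y_def)
    then show ?thesis unfolding 1 using 2 by linarith
  qed
  have e1: "(\<Sum>m\<in>root_idx N. root_mult a b m * (root_form m x)\<^sup>2 / (sin (root_form m w))\<^sup>2) =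
      (\<Sum>j<N. \<Sum>k<j. B k j * (x k + x j)\<^sup>2 + A k j * (x k - x j)\<^sup>2) + (\<Sum>j<N. T j * (x j)\<^sup>2)"
  proof -
    let ?g = "\<lambda>m. root_mult a b m * (root_form m x)\<^sup>2 / (sin (root_form m w))\<^sup>2"
    have "(\<Sum>j<N. \<Sum>k<j. ?g (j, k, True) + ?g (j, k, False)) =
        (\<Sum>j<N. \<Sum>k<j. B k j * (x k + x j)\<^sup>2 + A k j * (x k - x j)\<^sup>2)"
      by (intro sum.cong refl) (simp add: A_def B_def)
    moreover have "?g (j, j, True) + ?g (j, j, False) = T j * (x j)\<^sup>2" for j
    proof -
      have "b * (2 * x j)\<^sup>2 = 4 * b * (x j)\<^sup>2" by (simp add: power_mult_distrib)
      then show ?thesis by (simp add: T_def distrib_right)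
    qed
    ultimately show ?thesis unfolding sum_root_idx by (simp only:)
  qed
  have "(\<Sum>j<N. \<Sum>k<j. B k j * (x k + x j)\<^sup>2 + A k j * (x k - x j)\<^sup>2) =
    (\<Sum>j<N. \<Sum>k<j. ((A k j + B k j) * (x k)\<^sup>2 + (B k j - A k j) * (x k * x j)) + ((A j k + B j k) * (x j)\<^sup>2 + (B j k - A j k) * (x j * x k)))"
  proof (intro sum.cong refl)
    fix j k
    show "B k j * (x k + x j)\<^sup>2 + A k j * (x k - x j)\<^sup>2 =
      ((A k j + B k j) * (x k)\<^sup>2 + (B k j - A k j) * (x k * x j)) + ((A j k + B j k) * (x j)\<^sup>2 + (B j k - A j k) * (x j * x k))"
      unfolding symA[of j k] symB[of j k] by (simp add: power2_eq_square algebra_simps)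
  qed
  also have "\<dots> = (\<Sum>i<N. \<Sum>k\<in>{..<N} - {i}. (A i k + B i k) * (x i)\<^sup>2 + (B i k - A i k) * (x i * x k))"
    by (rule sum_off_diagonal[symmetric])
  finally have e2: "(\<Sum>j<N. \<Sum>k<j. B k j * (x k + x j)\<^sup>2 + A k j * (x k - x j)\<^sup>2) =
    (\<Sum>i<N. \<Sum>k\<in>{..<N} - {i}. (A i k + B i k) * (x i)\<^sup>2 + (B i k - A i k) * (x i * x k))" .
  have e3: "(\<Sum>i<N. \<Sum>k\<in>{..<N} - {i}. (A i k + B i k) * (x i)\<^sup>2 + (B i k - A i k) * (x i * x k)) + (\<Sum>j<N. T j * (x j)\<^sup>2) = quad_form N (hess N z a b) x"
    unfolding quad_form_def sum.distrib[symmetric]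
  proof (rule sum.cong[OF refl])
    fix i assume "i \<in> {..<N}"
    then have i: "i < N" by simp
    have "(\<Sum>j<N. x i * hess N z a b i j * x j) = hess N z a b i i * (x i)\<^sup>2 + (\<Sum>k\<in>{..<N} - {i}. x i * hess N z a b i k * x k)"
      using i by (subst sum.remove[of _ i]) (auto simp: power2_eq_square)
    also have "(\<Sum>k\<in>{..<N} - {i}. x i * hess N z a b i k * x k) = (\<Sum>k\<in>{..<N} - {i}. (B i k - A i k) * (x i * x k))"
      using AB(1)[OF i] by (intro sum.cong refl) (auto simp: mult_ac)
    finally have L: "(\<Sum>j<N. x i * hess N z a b i j * x j) =
      hess N z a b i i * (x i)\<^sup>2 + (\<Sum>k\<in>{..<N} - {i}. (B i k - A i k) * (x i * x k))" .
    have "(\<Sum>k\<in>{..<N} - {i}. (A i k + B i k) * (x i)\<^sup>2 + (B i k - A i k) * (x i * x k)) =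
      (\<Sum>k\<in>{..<N} - {i}. A i k + B i k) * (x i)\<^sup>2 + (\<Sum>k\<in>{..<N} - {i}. (B i k - A i k) * (x i * x k))"
      unfolding sum_distrib_right by (rule sum.distrib)
    then show "(\<Sum>k\<in>{..<N} - {i}. (A i k + B i k) * (x i)\<^sup>2 + (B i k - A i k) * (x i * x k)) + T i * (x i)\<^sup>2
       = (\<Sum>j<N. x i * hess N z a b i j * x j)"
      unfolding L diag[OF i] distrib_right[of _ "T i"] by linarith
  qed
  show ?thesis by (simp only: e1 e2 e3)
qed

lemma chamberA_sets: "chamberA N \<in> sets (lebN N)"
proof -
  have "chamberA N \<in> sets borel" by (intro borel_closed compact_imp_closed compact_chamberA)
  from measurable_sets[OF lebN_id_measurable_borel this, of N]
  have "(\<lambda>x. x) -` chamberA N \<inter> space (lebN N) \<in> sets (lebN N)" .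
  also have "(\<lambda>x. x) -` chamberA N \<inter> space (lebN N) = chamberA N"
    by (auto simp: chamberA_def space_PiM)
  finally show ?thesis .
qed

lemma trig_dens_measurable: "trig_dens N a b \<kappa> \<in> borel_measurable (lebN N)"
proof -
  have rp: "(\<lambda>t. rpow (f t) p) \<in> borel_measurable (lebN N)" if "f \<in> borel_measurable (lebN N)" for f p
    using that by (cases "p = 0") (auto simp: rpow_def)
  show ?thesis unfolding trig_dens_def
    by (intro borel_measurable_times borel_measurable_prod rp) auto
qed

section \<open>The limit theorem\<close>

lemma trig_clt:
  fixes a b :: real
  assumes a: "a \<ge> 0" and b: "b > 0"
    and w: "\<And>m. m \<in> root_idx N \<Longrightarrow> 0 < root_form m w \<and> root_form m w < pi"
    and crit: "\<And>x. (\<Sum>m\<in>root_idx N. root_mult a b m * cot (root_form m w) * root_form m x) = 0"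
    and z: "\<And>i. i < N \<Longrightarrow> z i = cos (2 * w i)"
  shows "quad_form N (hess N z a b) x \<ge> 4 * b * (\<Sum>i<N. (x i)\<^sup>2)"
    and "conv_distr N (\<lambda>\<kappa>. distr (law_X N a b \<kappa>) (lebN N) (affN N (sqrt \<kappa>) w)) (gauss_law N (hess N z a b))"
proof -
  have qf: "quad_form N (hess N z a b) x =
      (\<Sum>m\<in>root_idx N. root_mult a b m * (root_form m x)\<^sup>2 / (sin (root_form m w))\<^sup>2)" for x
    by (rule hess_quad_form[OF w crit z])
  have coer: "quad_form N (hess N z a b) x \<ge> 4 * b * (\<Sum>i<N. (x i)\<^sup>2)" for x
  proof -
    have "(\<Sum>m\<in>root_idx N. root_mult a b m * (root_form m x)\<^sup>2) \<le> quad_form N (hess N z a b) x"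
      unfolding qf
    proof (rule sum_mono)
      fix m assume m: "m \<in> root_idx N"
      have "0 < (sin (root_form m w))\<^sup>2" using w[OF m] sin_gt_zero[of "root_form m w"] by simp
      moreover have "(sin (root_form m w))\<^sup>2 \<le> 1" by (simp add: abs_square_le_1)
      moreover have "0 \<le> root_mult a b m * (root_form m x)\<^sup>2" using root_mult_nonneg[OF a b] by simp
      ultimately show "root_mult a b m * (root_form m x)\<^sup>2 \<le> root_mult a b m * (root_form m x)\<^sup>2 / (sin (root_form m w))\<^sup>2"
        by (simp add: le_divide_eq mult_left_le)
    qed
    then show ?thesis using root_form_coercive[OF a, where b = b and N = N and x = x] by linarith
  qed
  show "quad_form N (hess N z a b) x \<ge> 4 * b * (\<Sum>i<N. (x i)\<^sup>2)" by (rule coer)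
  define K where "K \<kappa> = (\<Prod>j<N. \<Prod>i<j. rpow 2 \<kappa>)" for \<kappa>
  have K: "K \<kappa> > 0" for \<kappa> unfolding K_def by (intro prod_pos) (simp add: rpow_pos)
  have td: "trig_dens N a b \<kappa> t = K \<kappa> * root_dens N a b \<kappa> t" if "t \<in> chamberA N" for t \<kappa>
    unfolding K_def by (rule trig_dens_root_dens[OF that])
  have Dw: "root_dens N a b \<kappa> w > 0" for \<kappa>
    using root_dens_interior[of N w a b \<kappa>] w by simp
  have b4: "4 * b > 0" using b by simp
  show "conv_distr N (\<lambda>\<kappa>. distr (law_X N a b \<kappa>) (lebN N) (affN N (sqrt \<kappa>) w)) (gauss_law N (hess N z a b))"
    unfolding law_X_def
  \<comment> \<open>D is the value of the density at w, so the rescaled densities are 1 at the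
    origin.\<close>
  proof (rule laplace_conv_distr[where D = "\<lambda>\<kappa>. K \<kappa> * root_dens N a b \<kappa> w" and e = "2 * b"])
    show "(\<lambda>t. indicator (chamberA N) t * trig_dens N a b \<kappa> t) \<in> borel_measurable (lebN N)" for \<kappa>
      by (intro borel_measurable_times borel_measurable_indicator chamberA_sets trig_dens_measurable)
    show "0 \<le> trig_dens N a b \<kappa> t" for \<kappa> t
      unfolding trig_dens_def by (intro mult_nonneg_nonneg prod_nonneg) (auto intro: rpow_nonneg)
    show "2 * b > 0" using b by simp
    show "K \<kappa> * root_dens N a b \<kappa> w > 0" for \<kappa> using K Dw by simp
    show "trig_dens N a b \<kappa> t \<le> K \<kappa> * root_dens N a b \<kappa> w * exp (- \<kappa> * (2 * b) * (\<Sum>i<N. (t i - w i)\<^sup>2))"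
      if "\<kappa> > 0" "t \<in> chamberA N" for \<kappa> t
      unfolding td[OF that(2)] mult.assoc[of "K \<kappa>"]
      using root_dens_bound[OF a b w crit that(2,1)] K[of \<kappa>] by (intro mult_left_mono) auto
    show "((\<lambda>\<kappa>. indicator (chamberA N) (\<lambda>i\<in>{..<N}. w i + x i / sqrt \<kappa>)
        * trig_dens N a b \<kappa> (\<lambda>i\<in>{..<N}. w i + x i / sqrt \<kappa>) / (K \<kappa> * root_dens N a b \<kappa> w))
        \<longlongrightarrow> exp (- quad_form N (hess N z a b) x / 2)) at_top" for x
    proof -
      have "indicator (chamberA N) t * trig_dens N a b \<kappa> t / (K \<kappa> * root_dens N a b \<kappa> w) =
        indicator (chamberA N) t * root_dens N a b \<kappa> t / root_dens N a b \<kappa> w" for t \<kappa>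
        using K[of \<kappa>] td[of t \<kappa>] by (cases "t \<in> chamberA N") simp_all
      then show ?thesis unfolding qf using root_dens_limit[OF w crit, of x] by simp
    qed
    show "gauss_Z N (hess N z a b) > 0" by (rule gauss_Z_pos[OF hess_sym b4 coer])
  qed
qed

theorem theorem2p5:
  fixes N :: nat and a b :: real
  assumes "N \<ge> 1" and "a \<ge> 0" and "b > 0"
  defines "al \<equiv> a + b - 1" and "be \<equiv> b - 1"
  defines "z \<equiv> jacobi_zero N al be"
  defines "w \<equiv> (\<lambda>i. arccos (z i) / 2)"
  defines "S \<equiv> mat N N (\<lambda>(i, j).
              if i = j then
                4 * (\<Sum>l\<in>{..<N} - {j}. (1 - (z j)\<^sup>2) / (z j - z l)\<^sup>2)
                + 2 * (a + b) * (1 + z j) / (1 - z j) + 2 * b * (1 - z j) / (1 + z j)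
              else - 4 * sqrt ((1 - (z j)\<^sup>2) * (1 - (z i)\<^sup>2)) / (z i - z j)\<^sup>2)"
  defines "lam \<equiv> (\<lambda>k::nat. 2 * real k * (2 * real N + al + be + 1 - real k))"
  shows "(\<exists>Cov \<in> carrier_mat N N. Cov * S = 1\<^sub>m N \<and> S * Cov = 1\<^sub>m N \<and>
            (\<exists>\<nu>. centered_normal N Cov \<nu> \<and>
               conv_distr N (\<lambda>\<kappa>. distr (law_X N a b \<kappa>) (lebN N)
                                   (\<lambda>t. \<lambda>i\<in>{..<N}. sqrt \<kappa> * (t i - w i))) \<nu>))
       \<and> char_poly S = (\<Prod>k\<in>{1..N}. [:- lam k, 1:])
       \<and> inj_on lam {1..N}
       \<and> (\<forall>k\<in>{1..N}. lam k > 0)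
       \<and> (\<exists>q :: nat \<Rightarrow> real poly.
            (\<forall>k<N. degree (q k) = k)
          \<and> (\<forall>k<N. \<forall>l<N. (\<Sum>i<N. (1 - (z i)\<^sup>2) * poly (q k) (z i) * poly (q l) (z i))
                          = (if k = l then 1 else 0))
          \<and> (\<forall>k\<in>{1..N}. eigenvector S
                (vec N (\<lambda>i. poly (q (k - 1)) (z i) * sqrt (1 - (z i)\<^sup>2))) (lam k)))"
proof -
  obtain w0 where w0: "w0 \<in> chamberA N" "\<And>m. m \<in> root_idx N \<Longrightarrow> 0 < root_form m w0 \<and> root_form m w0 < pi"
    "\<And>t. t \<in> chamberA N \<Longrightarrow> root_dens N a b 1 t \<le> root_dens N a b 1 w0"
    using root_dens_maximizer[OF \<open>a \<ge> 0\<close> \<open>b > 0\<close>] by blast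
  note crit0 = root_dens_critical[OF w0]
  have w0i: "0 < 2 * w0 i" "2 * w0 i < pi" if "i < N" for i
    using w0(2)[of "(i, i, True)"] that by (auto simp: root_idx_def)
  have mono: "strict_mono_on {..<N} (\<lambda>i. cos (2 * w0 i))"
  \<comment> \<open>Decreasing angles in [0, pi] have increasing cosines, which matches the index
    order of the sorted zeros.\<close>
  proof (rule strict_mono_onI)
    fix i j assume ij: "i \<in> {..<N}" "j \<in> {..<N}" "i < j"
    then have "w0 j < w0 i" using w0(2)[of "(j, i, False)"] by (auto simp: root_idx_def)
    then show "cos (2 * w0 i) < cos (2 * w0 j)"
      using w0i[of i] w0i[of j] ij by (intro cos_monotone_0_pi) auto
  qed
  have zw0: "z i = cos (2 * w0 i)" if "i < N" for i
    unfolding z_def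
  proof (rule jacobi_zero_stieltjes[OF mono \<open>N \<ge> 1\<close> _ _ _ that])
    show "al > -1" "be > -1" using \<open>a \<ge> 0\<close> \<open>b > 0\<close> by (auto simp: al_def be_def)
    show "2 * (1 - (cos (2 * w0 i))\<^sup>2) * (\<Sum>l\<in>{..<N} - {i}. 1 / (cos (2 * w0 i) - cos (2 * w0 l))) =
        al - be + (al + be + 2) * cos (2 * w0 i)" if "i < N" for i
      using critical_stieltjes[OF w0(2) crit0 that, of "\<lambda>i. cos (2 * w0 i)"]
      by (simp add: al_def be_def algebra_simps)
  qed
  \<comment> \<open>Agreement holds only below N: w0 is \<open>undefined\<close> beyond, w is not.
    The facts about w0 are therefore transferred through the forms, which read only indices below
    N.\<close>
  have ww0: "w i = w0 i" if "i < N" for i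
    using w0i[OF that] by (simp add: w_def zw0[OF that] arccos_cos)
  have rf: "root_form m w = root_form m w0" if "m \<in> root_idx N" for m
    using that ww0 by (rule root_form_cong)
  have w: "0 < root_form m w \<and> root_form m w < pi" if "m \<in> root_idx N" for m
    using w0(2)[OF that] rf[OF that] by simp
  have crit: "(\<Sum>m\<in>root_idx N. root_mult a b m * cot (root_form m w) * root_form m x) = 0" for x
    using crit0[of x] rf by simp
  have zw: "z i = cos (2 * w i)" if "i < N" for i using zw0 ww0 that by simp
  have zinj: "inj_on z {..<N}"
    using strict_mono_on_imp_inj_on[OF mono] zw0 by (auto simp: inj_on_def)
  have z1: "-1 < z i \<and> z i < 1" if "i < N" for i
    using cos_monotone_0_pi[of 0 "2 * w0 i"] cos_monotone_0_pi[of "2 * w0 i" pi] w0i[OF that] zw0[OF that] by simp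
  have st: "2 * (1 - (z i)\<^sup>2) * (\<Sum>l\<in>{..<N} - {i}. 1 / (z i - z l)) = a + (a + 2 * b) * z i" if "i < N" for i
    by (rule critical_stieltjes[OF w crit that zw])
  note clt = trig_clt[OF \<open>a \<ge> 0\<close> \<open>b > 0\<close> w crit zw]
  define H where "H = hess N z a b"
  have SH: "S = mat N N (\<lambda>(i, j). H i j)" by (simp add: S_def H_def hess_def)
  have S: "S \<in> carrier_mat N N" by (simp add: SH)
  have Sv: "(S *\<^sub>v v) $ j = (\<Sum>i<N. H j i * v $ i)" if "j < N" "v \<in> carrier_vec N" for j v
    using that by (simp add: SH scalar_prod_def atLeast0LessThan)

  obtain q where q: "\<And>k. k < N \<Longrightarrow> degree (q k) = k"
    "\<And>k l. k < N \<Longrightarrow> l < N \<Longrightarrow> (\<Sum>i<N. (1 - (z i)\<^sup>2) * poly (q k) (z i) * poly (q l) (z i)) = (if k = l then 1 else 0)"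
    "\<And>k j. k < N \<Longrightarrow> j < N \<Longrightarrow> (\<Sum>i<N. H j i * (poly (q k) (z i) * sqrt (1 - (z i)\<^sup>2))) =
       2 * (real k + 1) * (2 * real N + a + 2 * b - real k - 2) * (poly (q k) (z j) * sqrt (1 - (z j)\<^sup>2))"
    unfolding H_def using hess_eigenpolys[OF zinj z1 st \<open>a \<ge> 0\<close> \<open>b > 0\<close>] by blast
  \<comment> \<open>The index shift between the polynomial of degree k and the eigenvalue numbered k
    + 1.\<close>
  have lam: "lam (Suc k) = 2 * (real k + 1) * (2 * real N + a + 2 * b - real k - 2)" for k
    by (simp add: lam_def al_def be_def algebra_simps)
  have ev: "eigenvector S (vec N (\<lambda>i. poly (q (k - 1)) (z i) * sqrt (1 - (z i)\<^sup>2))) (lam k)" if kN: "k \<in> {1..N}" for k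
  proof -
    obtain k' where k: "k = Suc k'" "k' < N" using kN by (cases k) auto
    let ?v = "vec N (\<lambda>i. poly (q k') (z i) * sqrt (1 - (z i)\<^sup>2))"
    have "?v \<noteq> 0\<^sub>v N"
    proof
      assume v0: "?v = 0\<^sub>v N"
      have "poly (q k') (z i) = 0" if "i < N" for i
      proof -
        have "?v $ i = 0" using v0 that by simp
        moreover have "1 - (z i)\<^sup>2 > 0" using z1[OF that] by (simp add: abs_square_less_1 abs_less_iff)
        ultimately show ?thesis using that by simp
      qed
      then show False using q(2)[OF k(2) k(2)] by simp
    qed
    moreover have "S *\<^sub>v ?v = lam k \<cdot>\<^sub>v ?v"
      by (rule eq_vecI) (use S Sv q(3)[OF k(2)] lam[of k'] k in \<open>simp_all\<close>)
    ultimately show ?thesis using S unfolding eigenvector_def k by simp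
  qed
  have laminj: "inj_on lam {1..N}"
  proof (rule inj_onI)
    fix j k assume jk: "j \<in> {1..N}" "k \<in> {1..N}" "lam j = lam k"
    have "lam j - lam k = 2 * (real j - real k) * (2 * real N + a + 2 * b - 1 - real j - real k)"
      by (simp add: lam_def al_def be_def algebra_simps)
    moreover have "2 * real N + a + 2 * b - 1 - real j - real k > 0" if "j \<noteq> k"
    proof -
      \<comment> \<open>Distinct indices in 1..N add up to at most 2 N - 1.\<close>
      have "j + k + 1 \<le> 2 * N" using jk that by auto
      then have "real j + real k + 1 \<le> 2 * real N" by linarith
      then show ?thesis using \<open>a \<ge> 0\<close> \<open>b > 0\<close> by linarith
    qed
    ultimately show "j = k" using jk(3) by fastforce
  qed
  have lampos: "lam k > 0" if "k \<in> {1..N}" for k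
  proof -
    have "real k \<le> real N" "real N \<ge> 1" "real k > 0" using that \<open>N \<ge> 1\<close> by auto
    moreover from this have "2 * real N + al + be + 1 - real k > 0"
      using \<open>a \<ge> 0\<close> \<open>b > 0\<close> by (simp add: al_def be_def)
    ultimately show ?thesis unfolding lam_def by simp
  qed
  have cp: "char_poly S = (\<Prod>k\<in>{1..N}. [:- lam k, 1:])"
    using ev by (intro char_poly_distinct_eigenvalues[OF S _ _ laminj]) (auto simp: eigenvalue_def)

  have b4: "4 * b > 0" using \<open>b > 0\<close> by simp
  have quad: "v \<bullet> (S *\<^sub>v v) = quad_form N H (\<lambda>i. v $ i)" if "v \<in> carrier_vec N" for v
  proof -
    have "v \<bullet> (S *\<^sub>v v) = (\<Sum>i<N. v $ i * (S *\<^sub>v v) $ i)"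
      using S by (simp add: scalar_prod_def atLeast0LessThan del: index_mult_mat_vec)
    also have "\<dots> = (\<Sum>i<N. v $ i * (\<Sum>j<N. H i j * v $ j))"
      using Sv[OF _ that] by (intro sum.cong) auto
    finally show ?thesis by (simp add: quad_form_def sum_distrib_left mult.assoc)
  qed
  have "v \<bullet> (S *\<^sub>v v) > 0" if v: "v \<in> carrier_vec N" "v \<noteq> 0\<^sub>v N" for v
  proof -
    obtain i where i: "i < N" "v $ i \<noteq> 0" using v by (metis carrier_vecD eq_vecI index_zero_vec)
    have "(\<Sum>i<N. (v $ i)\<^sup>2) > 0" using i by (intro sum_pos2[of _ i]) auto
    then have "4 * b * (\<Sum>i<N. (v $ i)\<^sup>2) > 0" using b4 by simp
    then show ?thesis using clt(1)[of "\<lambda>i. v $ i"] unfolding quad[OF v(1)] H_def by linarith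
  qed
  then obtain Cov where Cov: "Cov \<in> carrier_mat N N" "Cov * S = 1\<^sub>m N" "S * Cov = 1\<^sub>m N"
    using pos_def_mat_inverse[OF S] by blast
  have inv: "(\<Sum>j<N. H i j * Cov $$ (j, k)) = (if i = k then 1 else 0)" if "i < N" "k < N" for i k
  proof -
    have "(S * Cov) $$ (i, k) = (\<Sum>j<N. H i j * Cov $$ (j, k))"
      using that Cov(1) by (simp add: SH scalar_prod_def atLeast0LessThan)
    then show ?thesis using Cov(3) that by simp
  qed
  have "centered_normal N Cov (gauss_law N H)"
    unfolding H_def by (rule gauss_law_centered_normal[OF hess_sym b4 clt(1) inv[unfolded H_def]])
  then have "\<exists>Cov \<in> carrier_mat N N. Cov * S = 1\<^sub>m N \<and> S * Cov = 1\<^sub>m N \<and>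
            (\<exists>\<nu>. centered_normal N Cov \<nu> \<and>
               conv_distr N (\<lambda>\<kappa>. distr (law_X N a b \<kappa>) (lebN N)
                                   (\<lambda>t. \<lambda>i\<in>{..<N}. sqrt \<kappa> * (t i - w i))) \<nu>)"
    using Cov clt(2) unfolding H_def by blast
  then show ?thesis using cp laminj lampos ev q(1,2) by blast
qed

end
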